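(* Suppose that: (a) $U:\mathcal{X}\times\mathcal{Y}\to\mathbb{R}$ is continuous and bounded; (b) $\mathcal{A}$ is convex and $\mathcal{A}_d$ is weakly compact (every sequence in $\mathcal{A}_d$ has a subsequence converging weakly to an element of $\mathcal{A}_d$); (c) for each fixed $y\in\mathcal{Y}$, $U(\cdot,y)$ is strictly concave on $\mathcal{X}$; (d) either $\varphi$ is superlinear (i.e. $\varphi'_\infty=\infty$), or $U$ has compact sublevel sets, i.e. $\{(x,y)\in\mathcal{X}\times\mathcal{Y}:U(x,y)\le\alpha\}$ is compact for every $\alpha\in\mathbb{R}$; (e) for every $\mu\in\mathcal{A}_d$ the set $\Gamma_\mu$ is weakly compact. Then for any $\eta\in\bigcup_{\theta\in(0,+\infty)}\partial J^{p,d}(\theta)$, the random distributionally robust optimization problem $$J^{c}(\eta)=\sup_{X\in\mathcal{A}}\ \inf_{Y\sim\nu\in D_\eta}\mathbb{E}[U(X,Y)]$$ admits at most one optimal decision $X\in\mathcal{A}$.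
   Context: $(\Omega,\mathcal{F},\mathbb{P})$ is a complete, non-atomic probability space. $\mathcal{X}\subset\mathbb{R}^n$ and $\mathcal{Y}\subset\mathbb{R}^m$ are closed convex sets. $\mathcal{P}(\cdot)$ denotes the set of Borel probability measures and $\mathcal{M}^+(\cdot)$ the set of finite positive Radon measures. The decision set $\mathcal{A}$ is a set of $\mathcal{X}$-valued random variables on $(\Omega,\mathcal{F},\mathbb{P})$ (random variables are identified when almost surely equal), and $\mathcal{A}_d:=\{\mu\in\mathcal{P}(\mathcal{X}):\mu\text{ is the law of some }X\in\mathcal{A}\}$. An entropy function is a convex lower semicontinuous function $\varphi:[0,\infty)\to[0,\infty]$ such that $\{s\ge0:\varphi(s)<\infty\}\cap(0,\infty)\neq\emptyset$; put $\varphi'_\infty:=\lim_{s\to\infty}\varphi(s)/s$. For $\mu,\nu\in\mathcal{M}^+(\mathcal{Y})$ with Lebesgue decomposition $\mu=\sigma_\mu\nu+\mu^\perp$ of $\mu$ with respect to $\nu$, the $\varphi$-divergence is $D_\varphi(\mu,\nu)=\int\varphi\circ\sigma_\mu\,d\nu+\varphi'_\infty\,\mu^\perp(\mathcal{Y})$, with $0\cdot\infty=0$. A fixed entropy function $\varphi$ and a benchmark law $\nu_0\in\mathcal{P}(\mathcal{Y})$ are given, and for $\eta\ge0$ the ambiguity set is $D_\eta=\{\nu\in\mathcal{P}(\mathcal{Y}):D_\varphi(\nu,\nu_0)\le\eta\}$. The notation $\inf_{Y\sim\nu\in D_\eta}$ means the infimum over all $\mathcal{Y}$-valued random variables $Y$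 on $(\Omega,\mathcal{F},\mathbb{P})$ whose law $\nu$ belongs to $D_\eta$. An optimal decision is an $X\in\mathcal{A}$ attaining the outer supremum. For a measure $\gamma$ on $\mathcal{X}\times\mathcal{Y}$, $\pi_1^\sharp\gamma,\pi_2^\sharp\gamma$ denote its marginals on $\mathcal{X}$ and $\mathcal{Y}$. Put $\mathcal{R}_2(\gamma):=D_\varphi(\pi_2^\sharp\gamma,\nu_0)$, $\Gamma_\mu:=\{\gamma\in\mathcal{P}(\mathcal{X}\times\mathcal{Y}):\pi_1^\sharp\gamma=\mu\}$ and $$J^{p,d}(\theta)=\sup_{\mu\in\mathcal{A}_d}\inf_{\gamma\in\Gamma_\mu}\Big\{\int U\,d\gamma+\theta\,\mathcal{R}_2(\gamma)\Big\},\quad\theta\ge0.$$ For a concave function $g$ on a convex set $C\subset\mathbb{R}^k$, the subdifferential is $\partial g(x)=\{x^*:\langle x^*,y-x\rangle\ge g(y)-g(x)\ \ \forall y\in C\}$; here it is applied to $J^{p,d}$ on $C=[0,\infty)$. *)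

theory Defs
  imports "HOL-Probability.Probability"
begin

section \<open>Probability measures on a subset of a topological space\<close>

abbreviation borel_on :: "'a::topological_space set \<Rightarrow> 'a measure" where
  "borel_on S \<equiv> restrict_space borel S"

definition prob_measures_on :: "'a::topological_space set \<Rightarrow> 'a measure set" where
  "prob_measures_on S = {\<mu>. prob_space \<mu> \<and> sets \<mu> = sets (borel_on S)}"

text \<open>Weak convergence is tested with the bounded continuous functions on \<open>S\<close>.\<close>

definition weakly_converges_on ::
    "'a::topological_space set \<Rightarrow> (nat \<Rightarrow> 'a measure) \<Rightarrow> 'a measure \<Rightarrow> bool" where
  "weakly_converges_on S \<mu>s \<mu> \<longleftrightarrow>
     (\<forall>f :: 'a \<Rightarrow> real. continuous_on S f \<and> bounded (f ` S) \<longrightarrow>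
        (\<lambda>n. \<integral>x. f x \<partial>\<mu>s n) \<longlonglongrightarrow> (\<integral>x. f x \<partial>\<mu>))"

definition weakly_compact_on :: "'a::topological_space set \<Rightarrow> 'a measure set \<Rightarrow> bool" where
  "weakly_compact_on S K \<longleftrightarrow>
     (\<forall>\<mu>s :: nat \<Rightarrow> 'a measure. (\<forall>n. \<mu>s n \<in> K) \<longrightarrow>
        (\<exists>\<mu>\<in>K. \<exists>r :: nat \<Rightarrow> nat. strict_mono r \<and> weakly_converges_on S (\<mu>s \<circ> r) \<mu>))"

definition nonatomic :: "'w measure \<Rightarrow> bool" where
  "nonatomic M \<longleftrightarrow>
     (\<forall>A\<in>sets M. 0 < emeasure M A \<longrightarrow>
        (\<exists>B\<in>sets M. B \<subseteq> A \<and> 0 < emeasure M B \<and> emeasure M B < emeasure M A))"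


section \<open>Entropy functions and divergences\<close>

text \<open>An entropy function lives on \<open>[0,\<infinity>)\<close>; the values of \<open>\<phi>\<close> at negative arguments are
  never used.\<close>

definition entropy_function :: "(real \<Rightarrow> ennreal) \<Rightarrow> bool" where
  "entropy_function \<phi> \<longleftrightarrow>
     (\<forall>s\<ge>0. \<forall>t\<ge>0. \<forall>u\<in>{0..1}.
        \<phi> ((1 - u) * s + u * t) \<le> ennreal (1 - u) * \<phi> s + ennreal u * \<phi> t) \<and>
     (\<forall>s\<ge>0. \<phi> s \<le> Liminf (at s within {0..}) \<phi>) \<and>
     {s. 0 \<le> s \<and> \<phi> s < \<infinity>} \<inter> {0<..} \<noteq> {}"

definition recession_slope :: "(real \<Rightarrow> ennreal) \<Rightarrow> ennreal" where
  "recession_slope \<phi> = Lim at_top (\<lambda>s. \<phi> s / ennreal s)"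

text \<open>\<open>\<mu> = \<sigma> \<nu> + \<mu>\<^sub>s\<close> with \<open>\<mu>\<^sub>s\<close> singular to \<open>\<nu>\<close>. The library's
  \<^const>\<open>RN_deriv\<close> cannot serve as \<open>\<sigma>\<close>: it is the zero function as soon as
  \<open>\<mu>\<close> is not absolutely continuous.\<close>

definition lebesgue_decomposition ::
    "'a measure \<Rightarrow> 'a measure \<Rightarrow> ('a \<Rightarrow> real) \<Rightarrow> 'a measure \<Rightarrow> bool" where
  "lebesgue_decomposition \<mu> \<nu> \<sigma> \<mu>s \<longleftrightarrow>
     \<sigma> \<in> borel_measurable \<nu> \<and> (\<forall>x. 0 \<le> \<sigma> x) \<and> sets \<mu>s = sets \<nu> \<and>
     (\<exists>N\<in>sets \<nu>. emeasure \<nu> N = 0 \<and> emeasure \<mu>s (space \<nu> - N) = 0) \<and>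
     (\<forall>B\<in>sets \<nu>. emeasure \<mu> B = emeasure (density \<nu> (\<lambda>x. ennreal (\<sigma> x))) B + emeasure \<mu>s B)"

text \<open>The decomposition is unique up to \<open>\<nu>\<close>-null sets, so the value below does not depend
  on it. In \<^typ>\<open>ennreal\<close> and \<^typ>\<open>ereal\<close> we have \<open>0 * \<infinity> = 0\<close>.\<close>

definition phi_divergence :: "(real \<Rightarrow> ennreal) \<Rightarrow> 'a measure \<Rightarrow> 'a measure \<Rightarrow> ennreal" where
  "phi_divergence \<phi> \<mu> \<nu> =
     (THE d. \<exists>\<sigma> \<mu>s. lebesgue_decomposition \<mu> \<nu> \<sigma> \<mu>s \<and>
        d = (\<integral>\<^sup>+x. \<phi> (\<sigma> x) \<partial>\<nu>) + recession_slope \<phi> * emeasure \<mu>s (space \<mu>s))"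

definition ambiguity_set ::
    "'b::topological_space set \<Rightarrow> (real \<Rightarrow> ennreal) \<Rightarrow> 'b measure \<Rightarrow> real \<Rightarrow> 'b measure set" where
  "ambiguity_set Y \<phi> \<nu>0 \<eta> =
     {\<nu> \<in> prob_measures_on Y. enn2ereal (phi_divergence \<phi> \<nu> \<nu>0) \<le> ereal \<eta>}"


section \<open>Concavity\<close>

definition strictly_concave_on :: "'a::real_vector set \<Rightarrow> ('a \<Rightarrow> real) \<Rightarrow> bool" where
  "strictly_concave_on S f \<longleftrightarrow> convex S \<and>
     (\<forall>x\<in>S. \<forall>y\<in>S. \<forall>t. x \<noteq> y \<and> 0 < t \<and> t < 1 \<longrightarrow>
        (1 - t) * f x + t * f y < f ((1 - t) *\<^sub>R x + t *\<^sub>R y))"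

text \<open>As \<open>g\<close> may take infinite values, subgradients exist only at points where it is
  finite.\<close>

definition concave_subdifferential ::
    "'a::real_inner set \<Rightarrow> ('a \<Rightarrow> ereal) \<Rightarrow> 'a \<Rightarrow> 'a set" where
  "concave_subdifferential C g x =
     {v. \<bar>g x\<bar> \<noteq> \<infinity> \<and> (\<forall>y\<in>C. ereal (inner v (y - x)) \<ge> g y - g x)}"


section \<open>The decision set\<close>

text \<open>Random variables are identified when almost surely equal: a set of random variables is
  given by representatives, and its convexity is that of the set of classes.\<close>

definition convex_decisions :: "'w measure \<Rightarrow> ('w \<Rightarrow> 'a::real_vector) set \<Rightarrow> bool" where
  "convex_decisions M A \<longleftrightarrow>
     (\<forall>X1\<in>A. \<forall>X2\<in>A. \<forall>t\<in>{0..1}. \<exists>X\<in>A. AE \<omega> in M. X \<omega> = (1 - t) *\<^sub>R X1 \<omega> + t *\<^sub>R X2 \<omega>)"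

definition decision_laws ::
    "'w measure \<Rightarrow> 'a::topological_space set \<Rightarrow> ('w \<Rightarrow> 'a) set \<Rightarrow> 'a measure set" where
  "decision_laws M S A = {\<mu> \<in> prob_measures_on S. \<exists>X\<in>A. \<mu> = distr M (borel_on S) X}"


section \<open>The two optimization problems\<close>

definition joint_laws ::
    "'a::topological_space set \<Rightarrow> 'b::topological_space set \<Rightarrow> 'a measure \<Rightarrow> ('a \<times> 'b) measure set"
  where "joint_laws S T \<mu> = {\<gamma> \<in> prob_measures_on (S \<times> T). distr \<gamma> (borel_on S) fst = \<mu>}"

definition penalized_value ::
    "'w measure \<Rightarrow> 'a::topological_space set \<Rightarrow> 'b::topological_space set \<Rightarrow> ('w \<Rightarrow> 'a) set \<Rightarrow>
     ('a \<times> 'b \<Rightarrow> real) \<Rightarrow> (real \<Rightarrow> ennreal) \<Rightarrow> 'b measure \<Rightarrow> real \<Rightarrow> ereal" where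
  "penalized_value M S T A U \<phi> \<nu>0 \<theta> =
     (SUP \<mu>\<in>decision_laws M S A. INF \<gamma>\<in>joint_laws S T \<mu>.
        ereal (\<integral>z. U z \<partial>\<gamma>)
        + ereal \<theta> * enn2ereal (phi_divergence \<phi> (distr \<gamma> (borel_on T) snd) \<nu>0))"

definition worst_case_value ::
    "'w measure \<Rightarrow> 'b::topological_space set \<Rightarrow> ('a \<times> 'b \<Rightarrow> real) \<Rightarrow> (real \<Rightarrow> ennreal) \<Rightarrow>
     'b measure \<Rightarrow> real \<Rightarrow> ('w \<Rightarrow> 'a) \<Rightarrow> ereal" where
  "worst_case_value M T U \<phi> \<nu>0 \<eta> X =
     (INF Y\<in>{Y \<in> M \<rightarrow>\<^sub>M borel_on T. distr M (borel_on T) Y \<in> ambiguity_set T \<phi> \<nu>0 \<eta>}.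
        ereal (\<integral>\<omega>. U (X \<omega>, Y \<omega>) \<partial>M))"

definition constrained_value ::
    "'w measure \<Rightarrow> 'b::topological_space set \<Rightarrow> ('w \<Rightarrow> 'a) set \<Rightarrow> ('a \<times> 'b \<Rightarrow> real) \<Rightarrow>
     (real \<Rightarrow> ennreal) \<Rightarrow> 'b measure \<Rightarrow> real \<Rightarrow> ereal" where
  "constrained_value M T A U \<phi> \<nu>0 \<eta> = (SUP X\<in>A. worst_case_value M T U \<phi> \<nu>0 \<eta> X)"

definition optimal_decision ::
    "'w measure \<Rightarrow> 'b::topological_space set \<Rightarrow> ('w \<Rightarrow> 'a) set \<Rightarrow> ('a \<times> 'b \<Rightarrow> real) \<Rightarrow>
     (real \<Rightarrow> ennreal) \<Rightarrow> 'b measure \<Rightarrow> real \<Rightarrow> ('w \<Rightarrow> 'a) \<Rightarrow> bool" where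
  "optimal_decision M T A U \<phi> \<nu>0 \<eta> X \<longleftrightarrow>
     X \<in> A \<and> worst_case_value M T U \<phi> \<nu>0 \<eta> X = constrained_value M T A U \<phi> \<nu>0 \<eta>"

end

theory Submission
  imports Defs "HOL-Real_Asymp.Real_Asymp"
begin

text \<open>Testing the weak compactness of \<open>\<Gamma>\<^sub>\<mu>\<close> on \<open>\<mu> \<otimes> \<delta>\<^sub>y\<close> shows that \<open>\<Y>\<close> is compact. Hence strict
  concavity is uniform in \<open>y\<close>: if \<open>X1\<close> and \<open>X2\<close> differ with positive probability, the expected
  utility of their midpoint exceeds the average of theirs by some \<open>\<delta> > 0\<close>, whatever \<open>Y\<close> is.
  Two distinct optimal decisions are then beaten by their midpoint, unless the optimal value is
  \<open>\<infinity>\<close> because no \<open>Y\<close> has its law in the ambiguity set. The supergradient condition rules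
  this out: it forces \<open>\<phi> 1 \<le> \<eta>\<close>, so that \<open>\<nu>0\<close> itself is admissible, and
  a non-atomic space carries a random variable with law \<open>\<nu>0\<close>.\<close>

section \<open>Random variables of prescribed law on non-atomic spaces\<close>

text \<open>The infimum over \<open>Y\<close> need not be attained, and near-minimizers may change
  from one decision to another. An inequality that is strict for each single \<open>Y\<close> could
  be lost in the infimum, so the gap \<delta> has to be fixed before \<open>Y\<close>. For a fixed
  pair of points the concavity gap has a positive minimum over the compact \<Y>; for some
  \<open>n\<close> this minimum is at least \<open>1 / (n + 1)\<close> on an event of positive
  probability, and \<delta> is the product of the two numbers. The bound
  \<open>\<phi> 1 \<le> \<eta>\<close> rests on Jensen's inequality for laws that may have a part
  singular to \<open>\<nu>0\<close>, and for \<phi> that may be infinite at 1 or steep there. Lines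
  through points strictly below the graph at 1 replace the subgradient, and the recession slope pays
  for the mass that the singular part withdraws from the density. To realize \<open>\<nu>0\<close>,
  a random vector is encoded by countably many events, which are copied one after the other with the
  right joint probabilities.\<close>

lemma nonatomic_small_subset:
  assumes "finite_measure M" and "nonatomic M" and A: "A \<in> sets M" "0 < measure M A" and "0 < e"
  obtains B where "B \<in> sets M" "B \<subseteq> A" "0 < measure M B" "measure M B \<le> e"
proof -
  interpret finite_measure M by fact
  \<comment> \<open>Non-atomicity only yields a piece \<open>C\<close> of strictly smaller measure,
    with no rate. Either \<open>C\<close> or \<open>B - C\<close> has at most half the measure of
    \<open>B\<close>, and both are of positive measure.\<close>
  have halves: "\<exists>B\<in>sets M. B \<subseteq> A \<and> 0 < measure M B \<and> measure M B \<le> measure M A / 2 ^ n" for n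
  proof (induction n)
    case 0
    then show ?case using A by auto
  next
    case (Suc n)
    then obtain B where B: "B \<in> sets M" "B \<subseteq> A" "0 < measure M B" "measure M B \<le> measure M A / 2 ^ n"
      by blast
    then obtain C where C: "C \<in> sets M" "C \<subseteq> B" "0 < measure M C" "measure M C < measure M B"
      using \<open>nonatomic M\<close> by (auto simp: nonatomic_def emeasure_eq_measure ennreal_less_iff)
    have "measure M (B - C) = measure M B - measure M C"
      using B C by (simp add: finite_measure_Diff)
    moreover define h where "h = measure M A / 2 ^ n"
    moreover have "measure M A / 2 ^ Suc n = h / 2" by (simp add: h_def)
    ultimately have "(C \<subseteq> A \<and> 0 < measure M C \<and> measure M C \<le> measure M A / 2 ^ Suc n)
        \<or> (B - C \<subseteq> A \<and> 0 < measure M (B - C) \<and> measure M (B - C) \<le> measure M A / 2 ^ Suc n)"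
      using B C by (cases "measure M C \<le> h / 2") auto
    with B C show ?case
      by (metis sets.Diff)
  qed
  obtain n where "measure M A / e < 2 ^ n"
    using real_arch_pow[of 2] by auto
  then have "measure M A / 2 ^ n < e"
    using \<open>0 < e\<close> by (simp add: field_simps)
  with halves[of n] show thesis
    by (auto intro: that)
qed

text \<open>Sierpinski's theorem. If the union of a greedy chain fell short of \<open>b\<close>, a
  small set outside it could be adjoined at every stage. The gain would bound the increments of the
  chain away from 0, although their measures converge.\<close>

lemma nonatomic_subset_of_measure:
  assumes "finite_measure M" and "nonatomic M" and A: "A \<in> sets M" and b: "0 \<le> b" "b \<le> measure M A"
  obtains B where "B \<in> sets M" "B \<subseteq> A" "measure M B = b"
proof -
  interpret finite_measure M by fact
  define ok where "ok B \<longleftrightarrow> B \<in> sets M \<and> B \<subseteq> A \<and> measure M B \<le> b" for B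
  \<comment> \<open>Greedy exhaustion: each step gains at least half of what any admissible enlargement could.\<close>
  have step: "\<exists>C. ok C \<and> B \<subseteq> C \<and>
      (\<forall>E. ok E \<and> B \<subseteq> E \<longrightarrow> measure M E - measure M B \<le> 2 * (measure M C - measure M B))"
    if "ok B" for B
  proof (cases "\<exists>E. ok E \<and> B \<subseteq> E \<and> measure M B < measure M E")
    case False
    then show ?thesis using that by (metis diff_self diff_le_0_iff_le mult_zero_right not_le order_refl)
  next
    case True
    define s where "s = Sup (measure M ` {E. ok E \<and> B \<subseteq> E})"
    have bdd: "bdd_above (measure M ` {E. ok E \<and> B \<subseteq> E})"
      by (auto simp: ok_def intro!: bdd_aboveI[of _ b])
    have le: "measure M E \<le> s" if "ok E" "B \<subseteq> E" for E
      unfolding s_def by (rule cSup_upper[OF _ bdd]) (use that in auto)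
    have "measure M B < s" using True le by fastforce
    then have "(s + measure M B) / 2 < Sup (measure M ` {E. ok E \<and> B \<subseteq> E})"
      unfolding s_def[symmetric] by simp
    then obtain C where "ok C" "B \<subseteq> C" "(s + measure M B) / 2 < measure M C"
      using \<open>ok B\<close> by (subst (asm) less_cSup_iff[OF _ bdd]) auto
    then show ?thesis
      using le by (intro exI[of _ C]) (force simp: field_simps)
  qed
  have "\<exists>f. \<forall>n. ok (f n) \<and> (f n \<subseteq> f (Suc n) \<and> (\<forall>E. ok E \<and> f n \<subseteq> E \<longrightarrow>
      measure M E - measure M (f n) \<le> 2 * (measure M (f (Suc n)) - measure M (f n))))"
    using dependent_nat_choice[of "\<lambda>_. ok" "\<lambda>_ B C. B \<subseteq> C \<and>
      (\<forall>E. ok E \<and> B \<subseteq> E \<longrightarrow> measure M E - measure M B \<le> 2 * (measure M C - measure M B))"]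
      step b by (metis empty_subsetI measure_empty ok_def sets.empty_sets)
  then obtain f where ok: "\<And>n. ok (f n)" and sub: "\<And>n. f n \<subseteq> f (Suc n)"
    and greedy: "\<And>n E. ok E \<Longrightarrow> f n \<subseteq> E \<Longrightarrow>
      measure M E - measure M (f n) \<le> 2 * (measure M (f (Suc n)) - measure M (f n))"
    by blast
  let ?B = "\<Union>n. f n"
  have meas: "range f \<subseteq> sets M" using ok by (auto simp: ok_def)
  have lim: "(\<lambda>n. measure M (f n)) \<longlonglongrightarrow> measure M ?B"
    using meas sub by (intro finite_Lim_measure_incseq) (auto intro: incseq_SucI)
  have B: "?B \<in> sets M" "?B \<subseteq> A" using meas ok by (auto simp: ok_def)
  have "measure M ?B \<le> b"
    using lim ok by (intro LIMSEQ_le_const2) (auto simp: ok_def)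
  moreover have "\<not> measure M ?B < b"
  proof
    assume less: "measure M ?B < b"
    have "measure M (A - ?B) = measure M A - measure M ?B"
      using A B by (simp add: finite_measure_Diff)
    then have "0 < measure M (A - ?B)" using less b by simp
    then obtain E where E: "E \<in> sets M" "E \<subseteq> A - ?B" "0 < measure M E" "measure M E \<le> b - measure M ?B"
      using nonatomic_small_subset[of M "A - ?B" "b - measure M ?B"] assms B less by auto
    have mE: "measure M (?B \<union> E) = measure M ?B + measure M E"
      using B E by (intro finite_measure_Union) auto
    then have "ok (?B \<union> E)" using B E by (auto simp: ok_def)
    then have gain: "measure M (?B \<union> E) - measure M (f n) \<le> 2 * (measure M (f (Suc n)) - measure M (f n))" for n
      by (rule greedy) auto
    have "measure M (?B \<union> E) - measure M ?B \<le> 2 * (measure M ?B - measure M ?B)"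
      by (rule LIMSEQ_le[OF tendsto_diff[OF tendsto_const lim]
            tendsto_mult[OF tendsto_const tendsto_diff[OF LIMSEQ_Suc[OF lim] lim]]]) (use gain in blast)
    then show False using mE E by simp
  qed
  ultimately show thesis using that B by force
qed

text \<open>One step of the copying. \<open>2 * k + bit\<close> encodes the pair of an old value
  \<open>k\<close> and a new bit, with \<open>k = j div 2\<close> and the parity of \<open>j\<close>
  as decoding. Since the fibres of \<open>S\<close> and \<open>t\<close> over \<open>k\<close> have
  equal mass, a subset with the mass of \<open>C\<close> in the fibre can be carved out of each
  fibre of \<open>S\<close>; their union is \<open>B\<close>.\<close>

lemma nonatomic_split:
  fixes S :: "'w \<Rightarrow> nat" and t :: "'a \<Rightarrow> nat"
  assumes "prob_space M" and "nonatomic M" and "prob_space N"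
    and S[measurable]: "S \<in> M \<rightarrow>\<^sub>M count_space UNIV" and t[measurable]: "t \<in> N \<rightarrow>\<^sub>M count_space UNIV"
    and eq: "distr M (count_space UNIV) S = distr N (count_space UNIV) t"
    and C[measurable]: "C \<in> sets N"
  obtains B where "B \<in> sets M"
    "distr M (count_space UNIV) (\<lambda>\<omega>. 2 * S \<omega> + of_bool (\<omega> \<in> B)) =
      distr N (count_space UNIV) (\<lambda>x. 2 * t x + of_bool (x \<in> C))"
proof -
  interpret M: prob_space M by fact
  interpret N: prob_space N by fact
  let ?D = "\<lambda>k. t -` {k} \<inter> space N" and ?A = "\<lambda>k. S -` {k} \<inter> space M"
  have A[measurable]: "?A k \<in> sets M" and D[measurable]: "?D k \<in> sets N" for k by simp_all
  have mA: "measure M (?A k) = measure N (?D k)" for k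
    using arg_cong[OF eq, of "\<lambda>Q. measure Q {k}"] by (simp add: measure_distr)
  have "\<exists>B. B \<in> sets M \<and> B \<subseteq> ?A k \<and> measure M B = measure N (?D k \<inter> C)" for k
  proof -
    have "measure N (?D k \<inter> C) \<le> measure M (?A k)"
      unfolding mA by (intro N.finite_measure_mono) auto
    from nonatomic_subset_of_measure[OF M.finite_measure_axioms \<open>nonatomic M\<close> A _ this]
    show ?thesis by (metis measure_nonneg)
  qed
  then obtain B where B[measurable]: "\<And>k. B k \<in> sets M" and sub: "\<And>k. B k \<subseteq> ?A k"
    and mB: "\<And>k. measure M (B k) = measure N (?D k \<inter> C)" by metis
  define BB where "BB = (\<Union>k. B k)"
  have BB[measurable]: "BB \<in> sets M" unfolding BB_def by auto
  have BB_iff: "\<omega> \<in> BB \<longleftrightarrow> \<omega> \<in> B (S \<omega>)" for \<omega> using sub by (fastforce simp: BB_def)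
  have "distr M (count_space UNIV) (\<lambda>\<omega>. 2 * S \<omega> + of_bool (\<omega> \<in> BB)) =
      distr N (count_space UNIV) (\<lambda>x. 2 * t x + of_bool (x \<in> C))" (is "distr _ _ ?f = distr _ _ ?g")
  proof (rule measure_eqI_countable[where A=UNIV])
    fix j :: nat
    have f[measurable]: "?f \<in> M \<rightarrow>\<^sub>M count_space UNIV" and g[measurable]: "?g \<in> N \<rightarrow>\<^sub>M count_space UNIV"
      by (measurable)
    define k where "k = j div 2"
    have decode: "2 * a + of_bool p = j \<longleftrightarrow> a = k \<and> (p \<longleftrightarrow> odd j)" for a p
      unfolding k_def by (cases p) (simp_all, presburger+)
    have vim: "?f -` {j} = {\<omega>. S \<omega> = k \<and> (\<omega> \<in> BB \<longleftrightarrow> odd j)}"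
        "?g -` {j} = {x. t x = k \<and> (x \<in> C \<longleftrightarrow> odd j)}"
      by (simp_all add: vimage_def decode)
    have "measure M (?f -` {j} \<inter> space M) = measure N (?g -` {j} \<inter> space N)"
    proof (cases "even j")
      case True
      then have "?f -` {j} \<inter> space M = ?A k - B k" "?g -` {j} \<inter> space N = ?D k - (?D k \<inter> C)"
        using sub unfolding vim by (auto simp: BB_iff)
      moreover have "measure M (?A k - B k) = measure M (?A k) - measure M (B k)"
        using sub by (intro M.finite_measure_Diff) auto
      moreover have "measure N (?D k - (?D k \<inter> C)) = measure N (?D k) - measure N (?D k \<inter> C)"
        by (intro N.finite_measure_Diff) auto
      ultimately show ?thesis using mA mB by metis
    next
      case False
      then have "?f -` {j} \<inter> space M = B k" "?g -` {j} \<inter> space N = ?D k \<inter> C"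
        using sub unfolding vim by (auto simp: BB_iff)
      then show ?thesis using mB by simp
    qed
    then show "emeasure (distr M (count_space UNIV) ?f) {j} = emeasure (distr N (count_space UNIV) ?g) {j}"
      by (simp add: emeasure_distr M.emeasure_eq_measure N.emeasure_eq_measure)
  qed auto
  with BB show thesis by (rule that)
qed

section \<open>Binary codes and the joint law of a sequence of events\<close>

abbreviation bit_sequences :: "(nat \<Rightarrow> bool) measure" where
  "bit_sequences \<equiv> PiM UNIV (\<lambda>_. count_space UNIV)"

text \<open>The bits of membership in \<open>C 0\<close>, ..., \<open>C (n - 1)\<close> read as a
  binary numeral, \<open>C 0\<close> being the most significant digit. Equality of the laws of these
  numbers is equality of finite-dimensional distributions.\<close>

primrec code :: "(nat \<Rightarrow> 'a set) \<Rightarrow> nat \<Rightarrow> 'a \<Rightarrow> nat" where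
  "code C 0 x = 0"
| "code C (Suc n) x = 2 * code C n x + of_bool (x \<in> C n)"

lemma code_div: "code C (i + n) x div 2 ^ n = code C i x"
proof (induction n)
  case (Suc n)
  have "code C (i + Suc n) x div 2 ^ Suc n = code C (i + Suc n) x div 2 div 2 ^ n"
    by (simp add: div_mult2_eq)
  also have "code C (i + Suc n) x div 2 = code C (i + n) x" by simp
  finally show ?case using Suc by simp
qed simp

text \<open>Membership in \<open>C i\<close> is the last digit of the code of length
  \<open>Suc i\<close>; the \<open>n - Suc i\<close> digits appended after it are removed by the
  division.\<close>

lemma mem_iff_code:
  assumes "i < n"
  shows "x \<in> C i \<longleftrightarrow> odd (code C n x div 2 ^ (n - Suc i))"
  using code_div[of C "Suc i" "n - Suc i" x] assms by simp

lemma measurable_code[measurable]: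
  assumes [measurable]: "\<And>i. C i \<in> sets M"
  shows "code C n \<in> M \<rightarrow>\<^sub>M count_space UNIV"
  by (induction n) simp_all

lemma nonatomic_copy_of_events:
  assumes "prob_space M" and "nonatomic M" and "prob_space N" and C[measurable]: "\<And>i. C i \<in> sets N"
  obtains B where "\<And>i. B i \<in> sets M"
    "distr M bit_sequences (\<lambda>\<omega> i. \<omega> \<in> B i) = distr N bit_sequences (\<lambda>x i. x \<in> C i)"
proof -
  interpret M: prob_space M by fact
  interpret N: prob_space N by fact
  \<comment> \<open>The clause for \<open>n = 0\<close> pins the start of the recursion everywhere
    and not just in law; only then can \<open>S n\<close> be identified with
    \<open>code B n\<close>.\<close>
  let ?law = "\<lambda>n S. S \<in> M \<rightarrow>\<^sub>M count_space UNIV \<and> (n = 0 \<longrightarrow> S = (\<lambda>_. 0)) \<and>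
    distr M (count_space UNIV) S = distr N (count_space UNIV) (code C n)"
  let ?next = "\<lambda>S S'. \<exists>B\<in>sets M. S' = (\<lambda>\<omega>. 2 * S \<omega> + of_bool (\<omega> \<in> B))"
  have "\<exists>S. \<forall>n. ?law n (S n) \<and> ?next (S n) (S (Suc n))"
  proof (rule dependent_nat_choice)
    show "\<exists>S. ?law 0 S"
    proof -
      have "code C 0 = (\<lambda>_. 0)" by (simp add: fun_eq_iff)
      then show ?thesis
        by (intro exI[of _ "\<lambda>_. 0"]) (simp add: M.distr_const N.distr_const)
    qed
  next
    fix S n assume S: "?law n S"
    then have [measurable]: "S \<in> M \<rightarrow>\<^sub>M count_space UNIV" by simp
    obtain B where [measurable]: "B \<in> sets M"
      and "distr M (count_space UNIV) (\<lambda>\<omega>. 2 * S \<omega> + of_bool (\<omega> \<in> B)) =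
        distr N (count_space UNIV) (\<lambda>x. 2 * code C n x + of_bool (x \<in> C n))"
      using nonatomic_split[of M N S "code C n" "C n"] assms S by auto
    moreover have "code C (Suc n) = (\<lambda>x. 2 * code C n x + of_bool (x \<in> C n))"
      by (simp add: fun_eq_iff)
    ultimately show "\<exists>S'. ?law (Suc n) S' \<and> ?next S S'"
      by (intro exI[of _ "\<lambda>\<omega>. 2 * S \<omega> + of_bool (\<omega> \<in> B)"]) auto
  qed
  then obtain S where law: "\<And>n. ?law n (S n)" and "\<And>n. ?next (S n) (S (Suc n))" by blast
  then obtain B where B[measurable]: "\<And>n. B n \<in> sets M"
    and S_Suc: "\<And>n. S (Suc n) = (\<lambda>\<omega>. 2 * S n \<omega> + of_bool (\<omega> \<in> B n))" by metis
  have S_eq: "S n = code B n" for n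
  proof (induction n)
    case 0
    then show ?case using law[of 0] by (auto simp: fun_eq_iff)
  next
    case (Suc n)
    then show ?case by (simp add: S_Suc fun_eq_iff)
  qed
  have "distr M bit_sequences (\<lambda>\<omega> i. \<omega> \<in> B i) = distr N bit_sequences (\<lambda>x i. x \<in> C i)"
    (is "distr _ _ ?f = distr _ _ ?g")
  proof (rule measure_eqI_PiM_infinite)
    fix A :: "nat \<Rightarrow> bool set" and J :: "nat set" assume J: "finite J"
    have f[measurable]: "?f \<in> M \<rightarrow>\<^sub>M bit_sequences" and g[measurable]: "?g \<in> N \<rightarrow>\<^sub>M bit_sequences"
      by (auto intro!: measurable_PiM_single')
    let ?E = "prod_emb UNIV (\<lambda>_. count_space UNIV) J (Pi\<^sub>E J A)"
    have E[measurable]: "?E \<in> sets bit_sequences"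
      using J by (intro sets_PiM_I) auto
    obtain n where n: "\<And>j. j \<in> J \<Longrightarrow> j < n"
      using finite_nat_set_iff_bounded J by metis
    \<comment> \<open>As \<open>n\<close> exceeds every index in \<open>J\<close>, the cylinder
      depends only on the code of length \<open>n\<close> and becomes a set of numbers.\<close>
    let ?K = "{k. \<forall>j\<in>J. odd (k div 2 ^ (n - Suc j)) \<in> A j}"
    have "?f -` ?E \<inter> space M = code B n -` ?K \<inter> space M" "?g -` ?E \<inter> space N = code C n -` ?K \<inter> space N"
      using n by (auto simp: prod_emb_def restrict_PiE_iff Pi_iff mem_iff_code[where C=B and n=n] mem_iff_code[where C=C and n=n])
    moreover have "emeasure (distr M (count_space UNIV) (code B n)) ?K
        = emeasure (distr N (count_space UNIV) (code C n)) ?K"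
      using law[of n] by (simp add: S_eq)
    ultimately show "emeasure (distr M bit_sequences ?f) ?E = emeasure (distr N bit_sequences ?g) ?E"
      by (simp add: emeasure_distr)
  qed (auto intro!: M.finite_measure_distr measurable_PiM_single')
  with B show thesis by (rule that)
qed

text \<open>A vector is determined by the answers to countably many questions, whether its component
  along \<open>e\<close> exceeds the rational \<open>r\<close>. Thus \<open>Z\<close> is a
  measurable function \<open>H\<close> of a bit sequence, and applying \<open>H\<close> to a copy of
  that sequence on \<open>M\<close> gives a vector with the same law.\<close>

theorem nonatomic_realization:
  fixes Z :: "'a \<Rightarrow> 'b::euclidean_space"
  assumes "prob_space M" and "nonatomic M" and "prob_space N" and Z[measurable]: "Z \<in> borel_measurable N"
  obtains Y where "Y \<in> borel_measurable M" "distr M borel Y = distr N borel Z"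
proof -
  define q where "q = from_nat_into ((Basis :: 'b set) \<times> (\<rat> :: real set))"
  have "range q = Basis \<times> \<rat>"
    unfolding q_def by (intro range_from_nat_into) (auto intro!: countable_SIGMA countable_finite[OF finite_Basis] countable_rat Rats_0)
  then have q: "q i \<in> Basis \<times> \<rat>" "e \<in> Basis \<Longrightarrow> r \<in> \<rat> \<Longrightarrow> \<exists>i. q i = (e, r)" for i e r
    by (auto simp: image_iff) (metis SigmaI imageE)
  define C where "C i = {x \<in> space N. snd (q i) < Z x \<bullet> fst (q i)}" for i
  have C: "C i \<in> sets N" for i unfolding C_def by measurable
  obtain B where [measurable]: "\<And>i. B i \<in> sets M"
    and B: "distr M bit_sequences (\<lambda>\<omega> i. \<omega> \<in> B i) = distr N bit_sequences (\<lambda>x i. x \<in> C i)"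
      (is "distr _ _ ?f = distr _ _ ?g")
    using nonatomic_copy_of_events[of M N C] assms C by blast
  have [measurable]: "?f \<in> M \<rightarrow>\<^sub>M bit_sequences" "?g \<in> N \<rightarrow>\<^sub>M bit_sequences"
    using C by (auto intro!: measurable_PiM_single')
  \<comment> \<open>Each component is the supremum of the rationals that it was declared to exceed,
    with -\<infinity> for a negative answer. \<open>real_of_ereal\<close> gives some real value on
    sequences that come from no vector.\<close>
  define H where "H b = (\<Sum>e\<in>Basis. real_of_ereal
      (SUP i. if b i \<and> fst (q i) = e then ereal (snd (q i)) else -\<infinity>) *\<^sub>R e)" for b
  have H[measurable]: "H \<in> borel_measurable bit_sequences"
    unfolding H_def by measurable
  have "H (?g x) = Z x" if "x \<in> space N" for x
  proof (rule euclidean_eqI)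
    fix e :: 'b assume e: "e \<in> Basis"
    have "(SUP i. if x \<in> C i \<and> fst (q i) = e then ereal (snd (q i)) else -\<infinity>) = ereal (Z x \<bullet> e)"
    proof (rule antisym)
      show "(SUP i. if x \<in> C i \<and> fst (q i) = e then ereal (snd (q i)) else -\<infinity>) \<le> ereal (Z x \<bullet> e)"
        by (intro SUP_least) (auto simp: C_def)
      show "ereal (Z x \<bullet> e) \<le> (SUP i. if x \<in> C i \<and> fst (q i) = e then ereal (snd (q i)) else -\<infinity>)"
      proof (rule dense_le)
        fix z :: ereal assume z: "z < ereal (Z x \<bullet> e)"
        obtain w where "z < ereal w" "w < Z x \<bullet> e"
          using ereal_dense2[OF z] by auto
        moreover from this obtain r where "r \<in> \<rat>" "w < r" "r < Z x \<bullet> e"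
          using Rats_dense_in_real by blast
        moreover from this obtain i where "q i = (e, r)" using q e by blast
        ultimately show "z \<le> (SUP i. if x \<in> C i \<and> fst (q i) = e then ereal (snd (q i)) else -\<infinity>)"
          using that by (intro SUP_upper2[of i]) (auto simp: C_def intro: less_imp_le order_trans less_trans
              dest!: order.strict_trans[OF \<open>z < ereal w\<close>])
      qed
    qed
    with e show "H (?g x) \<bullet> e = Z x \<bullet> e"
      by (simp add: H_def inner_sum_left inner_Basis if_distrib sum.delta cong: if_cong)
  qed
  then have "distr N borel Z = distr N borel (H \<circ> ?g)"
    by (intro distr_cong) auto
  also have "\<dots> = distr M borel (H \<circ> ?f)"
    using arg_cong[OF B, of "\<lambda>Q. distr Q borel H"] by (simp add: distr_distr)
  finally show thesis
    by (intro that[of "H \<circ> ?f"]) auto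
qed

lemma nonatomic_realization_on:
  fixes T :: "'b::euclidean_space set"
  assumes "prob_space M" and "nonatomic M" and "closed T" and \<nu>: "\<nu> \<in> prob_measures_on T"
  obtains Y where "Y \<in> M \<rightarrow>\<^sub>M borel_on T" "distr M (borel_on T) Y = \<nu>"
proof -
  interpret M: prob_space M by fact
  interpret \<nu>: prob_space \<nu> using \<nu> by (simp add: prob_measures_on_def)
  have sets: "sets \<nu> = sets (borel_on T)" using \<nu> by (simp add: prob_measures_on_def)
  then have space: "space \<nu> = T" by (auto dest: sets_eq_imp_space_eq simp: space_restrict_space)
  have T[measurable]: "T \<in> sets borel" using \<open>closed T\<close> by simp
  obtain t0 where t0: "t0 \<in> T" using \<nu>.not_empty space by auto
  have id: "(\<lambda>y. y) \<in> borel_measurable \<nu>"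
    using measurable_restrict_space1[of "\<lambda>y. y" borel borel T] sets by (simp cong: measurable_cong_sets)
  then obtain Y where Y[measurable]: "Y \<in> borel_measurable M" and law: "distr M borel Y = distr \<nu> borel (\<lambda>y. y)"
    using nonatomic_realization[of M \<nu> "\<lambda>y. y"] assms \<nu>.prob_space_axioms by blast
  have law': "emeasure M (Y -` A \<inter> space M) = emeasure \<nu> (A \<inter> T)" if "A \<in> sets borel" for A
    using arg_cong[OF law, of "\<lambda>Q. emeasure Q A"] that id by (simp add: emeasure_distr space)
  have "emeasure M (Y -` (- T) \<inter> space M) = 0" by (subst law') auto
  then have in_T: "AE \<omega> in M. Y \<omega> \<in> T"
    by (intro AE_I[of _ _ "Y -` (- T) \<inter> space M"]) auto
  \<comment> \<open>\<open>Y\<close> lies in \<open>T\<close> only almost surely, whereas a map into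
    \<open>borel_on T\<close> must do so everywhere; the exceptional null event is sent to
    \<open>t0\<close>.\<close>
  define Y' where "Y' \<omega> = (if Y \<omega> \<in> T then Y \<omega> else t0)" for \<omega>
  have [measurable]: "Y' \<in> borel_measurable M" unfolding Y'_def by measurable
  then have Y': "Y' \<in> M \<rightarrow>\<^sub>M borel_on T"
    by (intro measurable_restrict_space2) (auto simp: Y'_def t0)
  have "distr M (borel_on T) Y' = \<nu>"
  proof (rule measure_eqI)
    fix A assume "A \<in> sets (distr M (borel_on T) Y')"
    then have A: "A \<in> sets (borel_on T)" by simp
    then have [measurable]: "A \<in> sets borel" and "A \<subseteq> T"
      using T by (auto simp: sets_restrict_space_iff)
    have "emeasure (distr M (borel_on T) Y') A = emeasure M (Y' -` A \<inter> space M)"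
      using Y' A by (rule emeasure_distr)
    also have "\<dots> = emeasure M (Y -` A \<inter> space M)"
      using in_T by (intro emeasure_eq_AE) (auto simp: Y'_def elim!: eventually_mono)
    also have "\<dots> = emeasure \<nu> A" using \<open>A \<subseteq> T\<close> by (simp add: law' Int_absorb2)
    finally show "emeasure (distr M (borel_on T) Y') A = emeasure \<nu> A" .
  qed (simp add: sets)
  with Y' show thesis by (rule that)
qed

section \<open>Divergences\<close>

lemma entropy_convexD:
  assumes "entropy_function \<phi>" "0 \<le> s" "s < x" "x < t"
  shows "\<phi> x \<le> ennreal ((t - x) / (t - s)) * \<phi> s + ennreal ((x - s) / (t - s)) * \<phi> t"
proof -
  let ?u = "(x - s) / (t - s)"
  have "\<phi> ((1 - ?u) * s + ?u * t) \<le> ennreal (1 - ?u) * \<phi> s + ennreal ?u * \<phi> t"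
  proof -
    have "?u \<in> {0..1}" "0 \<le> t" using assms by auto
    then show ?thesis using assms(1,2) unfolding entropy_function_def by blast
  qed
  moreover have "(1 - ?u) * s + ?u * t = x"
  proof -
    have "(1 - u) * s + u * t = s + u * (t - s)" for u :: real by (simp add: algebra_simps)
    also have "s + ?u * (t - s) = x" using assms by simp
    finally show ?thesis .
  qed
  moreover have "1 - ?u = (t - x) / (t - s)" using assms by (simp add: field_simps)
  ultimately show ?thesis by simp
qed

lemma entropy_convexD_real:
  assumes "entropy_function \<phi>" "0 \<le> s" "s < x" "x < t" "\<phi> s < \<infinity>" "\<phi> t < \<infinity>"
  shows "\<phi> x \<le> ennreal (((t - x) * enn2real (\<phi> s) + (x - s) * enn2real (\<phi> t)) / (t - s))"
proof -
  have "\<phi> x \<le> ennreal ((t - x) / (t - s)) * ennreal (enn2real (\<phi> s))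
      + ennreal ((x - s) / (t - s)) * ennreal (enn2real (\<phi> t))"
    using entropy_convexD[OF assms(1-4)] assms(5,6) by simp
  also have "\<dots> = ennreal ((t - x) / (t - s) * enn2real (\<phi> s) + (x - s) / (t - s) * enn2real (\<phi> t))"
    using assms(2-4) by (subst ennreal_plus) (auto simp: ennreal_mult'[symmetric])
  finally show ?thesis by (simp add: add_divide_distrib)
qed

text \<open>\<open>Lim\<close> is meaningful only once a limit exists. The difference quotient of a
  convex function from \<open>s0\<close> is monotone, hence has a limit, possibly infinite;
  \<open>\<phi> s / s\<close> is this quotient times \<open>1 - s0 / s\<close> plus a term tending
  to 0. If \<phi> is infinite somewhere to the right of \<open>s0\<close>, convexity makes it
  infinite from there on.\<close>

lemma tendsto_recession_slope:
  assumes \<phi>: "entropy_function \<phi>"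
  shows "((\<lambda>s. \<phi> s / ennreal s) \<longlongrightarrow> recession_slope \<phi>) at_top"
proof -
  obtain s0 where s0: "0 < s0" "\<phi> s0 < \<infinity>" using \<phi> unfolding entropy_function_def by blast
  have "\<exists>L. ((\<lambda>s. \<phi> s / ennreal s) \<longlongrightarrow> L) at_top"
  proof (cases "\<exists>t>s0. \<phi> t = \<infinity>")
    case True
    then obtain t where t: "s0 < t" "\<phi> t = \<infinity>" by blast
    have "\<phi> s = \<infinity>" if "t < s" for s
    proof (rule ccontr)
      assume "\<phi> s \<noteq> \<infinity>"
      then have "\<phi> s < \<infinity>" by (simp add: top.not_eq_extremum)
      from entropy_convexD_real[OF \<phi> _ t(1) that s0(2) this] s0(1) t(2)
      show False by (simp add: top_unique)
    qed
    then have "\<phi> s / ennreal s = \<infinity>" if "t < s" for s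
      using that by (simp add: ennreal_top_divide)
    then have "((\<lambda>s. \<phi> s / ennreal s) \<longlongrightarrow> \<infinity>) at_top"
      by (intro tendsto_eventually) (auto intro: eventually_at_top_linorderI eventually_mono[OF eventually_gt_at_top[of t]])
    then show ?thesis by blast
  next
    case False
    define f where "f s = enn2real (\<phi> s)" for s
    have f: "\<phi> s = ennreal (f s)" if "s0 \<le> s" for s
      using that False s0 unfolding f_def
      by (cases "s = s0") (auto simp: top.not_eq_extremum)
    have f0: "0 \<le> f s" for s by (simp add: f_def)
    define G where "G s = (f s - f s0) / (s - s0)" for s
    have mono: "G s \<le> G t" if "s0 < s" "s < t" for s t
    proof -
      have "ennreal (f s) \<le> ennreal (((t - s) * f s0 + (s - s0) * f t) / (t - s0))"
        using entropy_convexD_real[OF \<phi> _ that] s0 f[of s] f[of s0] f[of t] that unfolding f_def[symmetric]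
        by (metis ennreal_less_top infinity_ennreal_def less_imp_le less_trans order_refl)
      then have "f s \<le> ((t - s) * f s0 + (s - s0) * f t) / (t - s0)"
        using that f0 by (subst (asm) ennreal_le_iff) auto
      then have "f s * (t - s0) \<le> (t - s) * f s0 + (s - s0) * f t"
        using that by (simp add: pos_le_divide_eq)
      then have "(f s - f s0) * (t - s0) \<le> (f t - f s0) * (s - s0)"
        by (simp add: algebra_simps)
      then show ?thesis
        using that by (simp add: G_def divide_le_eq le_divide_eq mult.commute)
    qed
    define L where "L = (SUP s\<in>{s0<..}. ereal (G s))"
    have GL: "((\<lambda>s. ereal (G s)) \<longlongrightarrow> L) at_top"
    proof (rule increasing_tendsto)
      show "\<forall>\<^sub>F s in at_top. ereal (G s) \<le> L"
        using eventually_gt_at_top[of s0] by eventually_elim (auto simp: L_def intro: SUP_upper)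
      fix x assume "x < L"
      then obtain s where s: "s0 < s" "x < ereal (G s)" by (auto simp: L_def less_SUP_iff)
      show "\<forall>\<^sub>F t in at_top. x < ereal (G t)"
        using eventually_gt_at_top[of s]
      proof eventually_elim
        case (elim t)
        then show ?case using mono[OF s(1)] s(2) by (metis ereal_less_eq(3) less_le_trans)
      qed
    qed
    have "L \<noteq> -\<infinity>"
      using SUP_upper[of "s0 + 1" "{s0<..}" "\<lambda>s. ereal (G s)"] by (auto simp: L_def)
    have div0: "((\<lambda>s. a / s) \<longlongrightarrow> 0) at_top" for a :: real
      by (rule tendsto_divide_0[OF tendsto_const filterlim_at_top_imp_at_infinity[OF filterlim_ident]])
    have "((\<lambda>s. ereal (1 - s0 / s)) \<longlongrightarrow> ereal 1) at_top" "((\<lambda>s. ereal (f s0 / s)) \<longlongrightarrow> ereal 0) at_top"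
      using tendsto_diff[OF tendsto_const div0, of 1 s0] div0[of "f s0"] by (auto intro!: tendsto_ereal)
    then have "((\<lambda>s. ereal (G s) * ereal (1 - s0 / s) + ereal (f s0 / s)) \<longlongrightarrow> L * ereal 1 + ereal 0) at_top"
      using GL \<open>L \<noteq> -\<infinity>\<close> by (intro tendsto_add_ereal_general tendsto_mult_ereal) auto
    then have "((\<lambda>s. e2ennreal (ereal (G s) * ereal (1 - s0 / s) + ereal (f s0 / s))) \<longlongrightarrow> e2ennreal L) at_top"
      by (intro tendsto_e2ennrealI) simp
    moreover have "\<forall>\<^sub>F s in at_top. e2ennreal (ereal (G s) * ereal (1 - s0 / s) + ereal (f s0 / s)) = \<phi> s / ennreal s"
      using eventually_gt_at_top[of s0]
    proof eventually_elim
      case (elim s)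
      have "G s * (1 - s0 / s) + f s0 / s = f s / s"
        using elim s0 by (simp add: G_def field_simps)
      then have "e2ennreal (ereal (G s) * ereal (1 - s0 / s) + ereal (f s0 / s)) = ennreal (f s / s)"
        by simp
      also have "\<dots> = \<phi> s / ennreal s"
        using elim s0 f[of s] f0[of s] by (simp add: divide_ennreal)
      finally show ?case .
    qed
    ultimately have "((\<lambda>s. \<phi> s / ennreal s) \<longlongrightarrow> e2ennreal L) at_top"
      by (rule Lim_transform_eventually)
    then show ?thesis by blast
  qed
  then show ?thesis unfolding recession_slope_def by (metis tendsto_Lim trivial_limit_at_top_linorder)
qed

text \<open>Dividing the minorant by \<open>s\<close> leaves its slope in the limit. This is how an
  affine minorant comes to control singular mass.\<close>

lemma recession_slope_ge:
  assumes \<phi>: "entropy_function \<phi>" and aff: "\<And>s. 0 \<le> s \<Longrightarrow> ennreal (r + c * (s - 1)) \<le> \<phi> s"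
    and "0 \<le> r" "0 \<le> c"
  shows "ennreal c \<le> recession_slope \<phi>"
proof (rule tendsto_le[OF _ tendsto_recession_slope[OF \<phi>]])
  have "((\<lambda>s. (r + c * (s - 1)) / s) \<longlongrightarrow> c) at_top"
    by real_asymp
  then show "((\<lambda>s. ennreal ((r + c * (s - 1)) / s)) \<longlongrightarrow> ennreal c) at_top"
    by (rule tendsto_ennrealI)
  show "\<forall>\<^sub>F s in at_top. ennreal ((r + c * (s - 1)) / s) \<le> \<phi> s / ennreal s"
    using eventually_ge_at_top[of 1]
  proof eventually_elim
    case (elim s)
    then have "ennreal ((r + c * (s - 1)) / s) = ennreal (r + c * (s - 1)) / ennreal s"
      using assms(3,4) by (subst divide_ennreal) auto
    also have "\<dots> \<le> \<phi> s / ennreal s" using elim aff by (intro divide_right_mono_ennreal) auto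
    finally show ?case .
  qed
qed simp

text \<open>The line passes through \<open>(1, r)\<close> below the graph, because a subgradient at
  1 may fail to exist. Slopes from this point to the graph on the left never exceed those to the
  graph on the right, and \<open>c\<close> is the supremum of the former.\<close>

lemma entropy_affine_minorant:
  assumes \<phi>: "entropy_function \<phi>" and r: "0 \<le> r" "ennreal r < \<phi> 1"
  obtains c where "\<And>s. 0 \<le> s \<Longrightarrow> ennreal (r + c * (s - 1)) \<le> \<phi> s"
proof -
  define F where "F s = enn2real (\<phi> s)" for s
  have F: "\<phi> s = ennreal (F s)" if "\<phi> s < \<infinity>" for s using that by (simp add: F_def)
  have F0: "0 \<le> F s" for s by (simp add: F_def)
  have "ennreal r < Liminf (at 1 within {0..}) \<phi>"
    using \<phi> r(2) unfolding entropy_function_def by (metis less_le_trans zero_le_one)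
  then have "\<forall>\<^sub>F s in at 1 within {0..}. ennreal r < \<phi> s" by (rule less_LiminfD)
  then obtain \<delta> where \<delta>: "0 < \<delta>" "\<And>s. 0 \<le> s \<Longrightarrow> s \<noteq> 1 \<Longrightarrow> \<bar>s - 1\<bar> < \<delta> \<Longrightarrow> ennreal r < \<phi> s"
    unfolding eventually_at by (auto simp: dist_real_def)
  have near: "r < F s" if "0 \<le> s" "s \<noteq> 1" "\<bar>s - 1\<bar> < \<delta>" "\<phi> s < \<infinity>" for s
    using \<delta>(2)[OF that(1-3)] F[OF that(4)] r(1) by (simp add: ennreal_less_iff)
  \<comment> \<open>The point \<open>- r / \<delta>\<close> only matters when \<open>\<phi>\<close> is infinite on \<open>[0, 1)\<close>.\<close>
  define A where "A = insert (- r / \<delta>) {(r - F s) / (1 - s) |s. 0 \<le> s \<and> s < 1 \<and> \<phi> s < \<infinity>}"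
  \<comment> \<open>Lower semicontinuity enters here: within \<delta> of 1 the graph is above
    \<open>r\<close>, so the quotient is negative, and farther away its numerator is at most
    \<open>r\<close> and its denominator at least \<delta>. This keeps \<open>Sup A\<close> finite
    even if \<phi> is infinite to the right of 1.\<close>
  have "a \<le> r / \<delta>" if "a \<in> A" for a
    using that unfolding A_def
  proof (elim insertE CollectE exE conjE)
    assume "a = - r / \<delta>"
    then show ?thesis using r \<delta>(1) by (simp add: divide_right_mono)
  next
    fix s assume s: "a = (r - F s) / (1 - s)" "0 \<le> s" "s < 1" "\<phi> s < \<infinity>"
    show ?thesis
    proof (cases "1 - s < \<delta>")
      case True
      then have "a \<le> 0" using near[of s] s by (auto simp: divide_le_0_iff)
      also have "0 \<le> r / \<delta>" using r \<delta> by simp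
      finally show ?thesis .
    next
      case False
      then show ?thesis using s r F0[of s] \<delta>(1) by (auto intro!: frac_le)
    qed
  qed
  then have bdd: "bdd_above A" by (rule bdd_aboveI)
  have right: "Sup A \<le> (F t - r) / (t - 1)" if t: "1 < t" "\<phi> t < \<infinity>" for t
  proof (rule cSup_least)
    fix a assume "a \<in> A"
    then show "a \<le> (F t - r) / (t - 1)"
      unfolding A_def
    proof (elim insertE CollectE exE conjE)
      assume a: "a = - r / \<delta>"
      show ?thesis
      proof (cases "t - 1 < \<delta>")
        case True
        then have "0 \<le> (F t - r) / (t - 1)" using near[of t] t by auto
        moreover have "a \<le> 0" using a r \<delta> by simp
        ultimately show ?thesis by simp
      next
        case False
        then have "r / (t - 1) \<le> r / \<delta>" using r \<delta>(1) by (intro frac_le) auto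
        moreover have "- r / (t - 1) \<le> (F t - r) / (t - 1)" using F0[of t] t by (intro divide_right_mono) auto
        ultimately show ?thesis using a by simp
      qed
    next
      fix s assume s: "a = (r - F s) / (1 - s)" "0 \<le> s" "s < 1" "\<phi> s < \<infinity>"
      \<comment> \<open>The chord from \<open>s\<close> to \<open>t\<close> lies above
        \<open>\<phi> 1\<close>, hence above \<open>r\<close>, at 1; cleared of denominators this is
        the comparison of the two slopes.\<close>
      have "ennreal r < ennreal (((t - 1) * F s + (1 - s) * F t) / (t - s))"
        using entropy_convexD_real[OF \<phi> s(2,3) t(1) s(4) t(2)] r(2) unfolding F_def by (rule less_le_trans[rotated])
      then have "r < ((t - 1) * F s + (1 - s) * F t) / (t - s)"
        using r(1) by (simp add: ennreal_less_iff)
      then have "r * (t - s) < (t - 1) * F s + (1 - s) * F t"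
        using s t by (simp add: pos_less_divide_eq)
      then have "(r - F s) * (t - 1) \<le> (F t - r) * (1 - s)" by (simp add: algebra_simps)
      then have "(r - F s) * (t - 1) / (1 - s) \<le> F t - r" using s by (simp only: pos_divide_le_eq diff_gt_0_iff_gt)
      then show ?thesis using s(1) t by (simp only: pos_le_divide_eq diff_gt_0_iff_gt times_divide_eq_left)
    qed
  qed (simp add: A_def)
  show thesis
  proof (rule that[of "Sup A"])
    fix s :: real assume s: "0 \<le> s"
    show "ennreal (r + Sup A * (s - 1)) \<le> \<phi> s"
    proof (cases "\<phi> s < \<infinity>")
      case fin: True
      have "r + Sup A * (s - 1) \<le> F s"
      proof -
        consider "s < 1" | "s = 1" | "1 < s" by linarith
        then show ?thesis
        proof cases
          case 1
          then have "(r - F s) / (1 - s) \<le> Sup A"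
            using s fin by (intro cSup_upper[OF _ bdd]) (auto simp: A_def)
          then show ?thesis using 1 by (simp add: pos_divide_le_eq algebra_simps)
        next
          case 2
          then show ?thesis using r fin F[of 1] F0 by (simp add: ennreal_less_iff)
        next
          case 3
          then show ?thesis using right[OF 3 fin] by (simp add: pos_le_divide_eq algebra_simps)
        qed
      qed
      then show ?thesis using F[OF fin] by (simp add: ennreal_leI)
    qed (simp add: not_less top_unique)
  qed
qed

section \<open>Existence and uniqueness of the Lebesgue decomposition\<close>

lemma lebesgue_decomposition_exists:
  assumes "finite_measure \<mu>" "finite_measure \<nu>" and sets[measurable_cong]: "sets \<mu> = sets \<nu>"
  obtains \<sigma> \<mu>s where "lebesgue_decomposition \<mu> \<nu> \<sigma> \<mu>s"
proof -
  interpret \<mu>: finite_measure \<mu> by fact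
  interpret \<nu>: finite_measure \<nu> by fact
  have space: "space \<mu> = space \<nu>" using sets by (rule sets_eq_imp_space_eq)
  \<comment> \<open>\<open>N\<close> will be a \<nu>-null set whose \<mu>-mass attains this
    supremum. A \<nu>-null set outside \<open>N\<close> is then \<mu>-null, as adjoining it would
    exceed \<open>s\<close>; so \<mu> off \<open>N\<close> is absolutely continuous.\<close>
  define s where "s = Sup (measure \<mu> ` null_sets \<nu>)"
  have bdd: "bdd_above (measure \<mu> ` null_sets \<nu>)"
    using \<mu>.bounded_measure by (auto intro!: bdd_aboveI)
  have "\<exists>N\<in>null_sets \<nu>. s - 1 / Suc n < measure \<mu> N" for n
    using less_cSup_iff[OF _ bdd, of "s - 1 / Suc n"] by (force simp: s_def)
  then obtain Ns where Ns: "\<And>n. Ns n \<in> null_sets \<nu>" "\<And>n. s - 1 / Suc n < measure \<mu> (Ns n)" by metis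
  define N where "N = (\<Union>n. Ns n)"
  have N: "N \<in> null_sets \<nu>" unfolding N_def using Ns by (intro null_sets_UN) auto
  then have [measurable]: "N \<in> sets \<nu>" by auto
  have "s - 1 / Suc n \<le> measure \<mu> N" for n
  proof -
    have "measure \<mu> (Ns n) \<le> measure \<mu> N"
      using sets Ns(1) by (intro \<mu>.finite_measure_mono) (auto simp: N_def)
    with Ns(2)[of n] show ?thesis by linarith
  qed
  moreover have "(\<lambda>n. s - 1 / Suc n) \<longlonglongrightarrow> s"
    by real_asymp
  ultimately have s: "s \<le> measure \<mu> N" by (intro LIMSEQ_le_const2) auto
  have null: "measure \<mu> (B - N) = 0" if B: "B \<in> null_sets \<nu>" for B
  proof -
    have "measure \<mu> (N \<union> (B - N)) = measure \<mu> N + measure \<mu> (B - N)"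
      using B N sets by (intro \<mu>.finite_measure_Union) auto
    moreover have "measure \<mu> (N \<union> (B - N)) \<le> s"
      unfolding s_def using B N by (intro cSup_upper[OF _ bdd] imageI) auto
    ultimately show ?thesis using s measure_nonneg[of \<mu> "B - N"] by linarith
  qed
  define \<mu>a where "\<mu>a = density \<mu> (indicator (space \<nu> - N))"
  define \<mu>s where "\<mu>s = density \<mu> (indicator N)"
  have ac: "emeasure \<mu>a B = emeasure \<mu> (B - N)" if "B \<in> sets \<nu>" for B
  proof -
    have "(space \<nu> - N) \<inter> B = B - N" using sets.sets_into_space[OF that] by auto
    then show ?thesis using that sets by (simp add: \<mu>a_def emeasure_restricted)
  qed
  have sing: "emeasure \<mu>s B = emeasure \<mu> (N \<inter> B)" if "B \<in> sets \<nu>" for B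
    using that sets by (simp add: \<mu>s_def emeasure_restricted)
  have "absolutely_continuous \<nu> \<mu>a"
    unfolding absolutely_continuous_def
  proof
    fix B assume B: "B \<in> null_sets \<nu>"
    then have "emeasure \<mu>a B = 0"
      using null[OF B] ac[of B] by (simp add: \<mu>.emeasure_eq_measure null_setsD2)
    moreover have "B \<in> sets \<mu>a" using B sets by (auto simp: \<mu>a_def)
    ultimately show "B \<in> null_sets \<mu>a" by (rule null_setsI)
  qed
  then obtain f where f[measurable]: "f \<in> borel_measurable \<nu>" and "density \<nu> f = \<mu>a"
    using \<nu>.Radon_Nikodym[of \<mu>a] sets by (auto simp: \<mu>a_def)
  \<comment> \<open>The density must be real-valued: finite total mass makes \<open>f\<close> finite
    almost everywhere, so \<open>enn2real\<close> does not change the measure.\<close>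
  have "(\<integral>\<^sup>+x. f x \<partial>\<nu>) = emeasure (density \<nu> f) (space \<nu>)"
    by (simp add: emeasure_density cong: nn_integral_cong)
  also have "\<dots> \<noteq> \<infinity>"
    using \<open>density \<nu> f = \<mu>a\<close> ac[of "space \<nu>"] \<mu>.emeasure_finite by simp
  finally have "AE x in \<nu>. f x \<noteq> \<infinity>" by (intro nn_integral_PInf_AE) auto
  then have "density \<nu> (\<lambda>x. ennreal (enn2real (f x))) = density \<nu> f"
    by (intro density_cong) (auto simp: top.not_eq_extremum)
  then have dens: "density \<nu> (\<lambda>x. ennreal (enn2real (f x))) = \<mu>a" using \<open>density \<nu> f = \<mu>a\<close> by simp
  have "lebesgue_decomposition \<mu> \<nu> (\<lambda>x. enn2real (f x)) \<mu>s"
    unfolding lebesgue_decomposition_def dens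
  proof (intro conjI ballI bexI[of _ N])
    show "emeasure \<mu>s (space \<nu> - N) = 0" by (subst sing) (auto simp: Diff_Int_distrib)
    fix B assume [measurable]: "B \<in> sets \<nu>"
    have "emeasure \<mu> B = emeasure \<mu> ((B - N) \<union> (N \<inter> B))" by (rule arg_cong[of _ _ "emeasure \<mu>"]) auto
    also have "\<dots> = emeasure \<mu>a B + emeasure \<mu>s B"
      by (subst plus_emeasure[symmetric]) (auto simp: ac sing)
    finally show "emeasure \<mu> B = emeasure \<mu>a B + emeasure \<mu>s B" .
  qed (use N sets in \<open>auto simp: \<mu>s_def\<close>)
  then show thesis by (rule that)
qed

text \<open>Relative to one \<nu>-null set \<open>N\<close> carrying both singular parts, the
  density part is \<mu> off \<open>N\<close> and the singular mass is that of \<open>N\<close> under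
  \<mu>; neither refers to the decomposition.\<close>

lemma lebesgue_decomposition_unique:
  assumes "finite_measure \<mu>" "finite_measure \<nu>" and [measurable_cong]: "sets \<mu> = sets \<nu>"
    and dec: "lebesgue_decomposition \<mu> \<nu> \<sigma>1 \<mu>1" "lebesgue_decomposition \<mu> \<nu> \<sigma>2 \<mu>2"
  shows "AE x in \<nu>. \<sigma>1 x = \<sigma>2 x" and "emeasure \<mu>1 (space \<mu>1) = emeasure \<mu>2 (space \<mu>2)"
proof -
  interpret \<mu>: finite_measure \<mu> by fact
  interpret \<nu>: finite_measure \<nu> by fact
  obtain N1 N2 where N12: "N1 \<in> null_sets \<nu>" "emeasure \<mu>1 (space \<nu> - N1) = 0"
      "N2 \<in> null_sets \<nu>" "emeasure \<mu>2 (space \<nu> - N2) = 0"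
    using dec unfolding lebesgue_decomposition_def by blast
  define N where "N = N1 \<union> N2"
  have N: "N \<in> null_sets \<nu>" using N12 by (auto simp: N_def)
  then have [measurable]: "N \<in> sets \<nu>" by auto
  have parts: "emeasure (density \<nu> (\<lambda>x. ennreal (\<sigma> x))) B = emeasure \<mu> (B - N)"
      "emeasure \<rho> (space \<rho>) = emeasure \<mu> N"
    if dec: "lebesgue_decomposition \<mu> \<nu> \<sigma> \<rho>" and N': "N' \<in> sets \<nu>" "N' \<subseteq> N" "emeasure \<rho> (space \<nu> - N') = 0"
      and [measurable]: "B \<in> sets \<nu>" for \<sigma> \<rho> N' B
  proof -
    from dec have [measurable]: "\<sigma> \<in> borel_measurable \<nu>" and \<rho>[measurable_cong]: "sets \<rho> = sets \<nu>"
      and sum: "\<And>B. B \<in> sets \<nu> \<Longrightarrow> emeasure \<mu> B = emeasure (density \<nu> (\<lambda>x. ennreal (\<sigma> x))) B + emeasure \<rho> B"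
      by (auto simp: lebesgue_decomposition_def)
    have zero: "emeasure \<rho> A = 0" if "A \<in> sets \<nu>" "A \<subseteq> space \<nu> - N" for A
      using emeasure_mono[of A "space \<nu> - N'" \<rho>] that N' \<rho> by auto
    have dens0: "emeasure (density \<nu> (\<lambda>x. ennreal (\<sigma> x))) A = 0" if "A \<in> sets \<nu>" "A \<subseteq> N" for A
    proof -
      have "A \<in> null_sets \<nu>" using that N null_sets_subset by blast
      then show ?thesis using absolutely_continuousI_density[of "\<lambda>x. ennreal (\<sigma> x)" \<nu>]
        by (auto simp: absolutely_continuous_def)
    qed
    let ?d = "density \<nu> (\<lambda>x. ennreal (\<sigma> x))"
    have "emeasure ?d B = emeasure ?d ((B - N) \<union> (B \<inter> N))"
      by (rule arg_cong[of _ _ "emeasure ?d"]) auto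
    also have "\<dots> = emeasure ?d (B - N) + emeasure ?d (B \<inter> N)"
      by (rule plus_emeasure[symmetric]) auto
    also have "\<dots> = emeasure \<mu> (B - N)"
      using sum[of "B - N"] zero[of "B - N"] dens0[of "B \<inter> N"] sets.sets_into_space[of B \<nu>] by auto
    finally show "emeasure ?d B = emeasure \<mu> (B - N)" .
    have "space \<rho> = (space \<nu> - N) \<union> N"
      using sets_eq_imp_space_eq[OF \<rho>] sets.sets_into_space[of N \<nu>] by auto
    then have "emeasure \<rho> (space \<rho>) = emeasure \<rho> ((space \<nu> - N) \<union> N)" by (simp only:)
    also have "\<dots> = emeasure \<rho> (space \<nu> - N) + emeasure \<rho> N"
      by (rule plus_emeasure[symmetric]) auto
    also have "\<dots> = emeasure \<mu> N"
      using sum[of N] zero[of "space \<nu> - N"] dens0[of N] by auto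
    finally show "emeasure \<rho> (space \<rho>) = emeasure \<mu> N" .
  qed
  note p1 = parts[OF dec(1) _ _ N12(2)] and p2 = parts[OF dec(2) _ _ N12(4)]
  have in_N: "N1 \<in> sets \<nu>" "N1 \<subseteq> N" "N2 \<in> sets \<nu>" "N2 \<subseteq> N" using N12 by (auto simp: N_def)
  show "emeasure \<mu>1 (space \<mu>1) = emeasure \<mu>2 (space \<mu>2)"
    using p1(2)[OF in_N(1,2) sets.top] p2(2)[OF in_N(3,4) sets.top] by simp
  have m[measurable]: "\<sigma>1 \<in> borel_measurable \<nu>" "\<sigma>2 \<in> borel_measurable \<nu>"
    and nonneg: "\<And>x. 0 \<le> \<sigma>1 x" "\<And>x. 0 \<le> \<sigma>2 x"
    using dec by (auto simp: lebesgue_decomposition_def)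
  have "density \<nu> (\<lambda>x. ennreal (\<sigma>1 x)) = density \<nu> (\<lambda>x. ennreal (\<sigma>2 x))"
    using p1(1)[OF in_N(1,2)] p2(1)[OF in_N(3,4)] by (intro measure_eqI) auto
  then have "AE x in \<nu>. ennreal (\<sigma>1 x) = ennreal (\<sigma>2 x)"
    by (subst (asm) \<nu>.density_unique_iff) auto
  then show "AE x in \<nu>. \<sigma>1 x = \<sigma>2 x" using nonneg by auto
qed

section \<open>Evaluation and lower bound of the divergence\<close>

lemma phi_divergence_eq:
  assumes "finite_measure \<mu>" "finite_measure \<nu>" "sets \<mu> = sets \<nu>" "lebesgue_decomposition \<mu> \<nu> \<sigma> \<mu>s"
  shows "phi_divergence \<phi> \<mu> \<nu> = (\<integral>\<^sup>+x. \<phi> (\<sigma> x) \<partial>\<nu>) + recession_slope \<phi> * emeasure \<mu>s (space \<mu>s)"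
  unfolding phi_divergence_def
proof (rule the_equality)
  fix d assume "\<exists>\<sigma> \<mu>s. lebesgue_decomposition \<mu> \<nu> \<sigma> \<mu>s \<and>
    d = (\<integral>\<^sup>+x. \<phi> (\<sigma> x) \<partial>\<nu>) + recession_slope \<phi> * emeasure \<mu>s (space \<mu>s)"
  then obtain \<sigma>' \<mu>s' where dec: "lebesgue_decomposition \<mu> \<nu> \<sigma>' \<mu>s'"
    and d: "d = (\<integral>\<^sup>+x. \<phi> (\<sigma>' x) \<partial>\<nu>) + recession_slope \<phi> * emeasure \<mu>s' (space \<mu>s')" by blast
  note uniq = lebesgue_decomposition_unique[OF assms(1-3) dec assms(4)]
  have "(\<integral>\<^sup>+x. \<phi> (\<sigma>' x) \<partial>\<nu>) = (\<integral>\<^sup>+x. \<phi> (\<sigma> x) \<partial>\<nu>)"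
    using uniq(1) by (intro nn_integral_cong_AE) auto
  then show "d = (\<integral>\<^sup>+x. \<phi> (\<sigma> x) \<partial>\<nu>) + recession_slope \<phi> * emeasure \<mu>s (space \<mu>s)"
    using d uniq(2) by simp
qed (use assms(4) in blast)

lemma phi_divergence_self:
  assumes "prob_space \<nu>"
  shows "phi_divergence \<phi> \<nu> \<nu> = \<phi> 1"
proof -
  interpret prob_space \<nu> by fact
  have "lebesgue_decomposition \<nu> \<nu> (\<lambda>_. 1) (null_measure \<nu>)"
    by (auto simp: lebesgue_decomposition_def density_1 intro!: bexI[of _ "{}"])
  from phi_divergence_eq[OF finite_measure_axioms finite_measure_axioms refl this, of \<phi>]
  show ?thesis by (simp add: emeasure_space_1)
qed

text \<open>Jensen's inequality with a singular part. The density has integral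
  \<open>t \<le> 1\<close>, and the deficit \<open>1 - t\<close> is the singular mass. Integrating a
  minorant through \<open>(1, r)\<close> gives \<open>r + c * (t - 1)\<close>; this is at least
  \<open>r\<close> if \<open>c \<le> 0\<close>, and otherwise the loss \<open>c * (1 - t)\<close> is
  made up by the recession slope. Finally \<open>r\<close> tends to \<open>\<phi> 1\<close>.\<close>

lemma phi_divergence_ge:
  assumes \<phi>: "entropy_function \<phi>" and "prob_space \<mu>" "prob_space \<nu>" and sets: "sets \<mu> = sets \<nu>"
  shows "\<phi> 1 \<le> phi_divergence \<phi> \<mu> \<nu>"
proof (rule dense_le)
  fix z assume z: "z < \<phi> 1"
  then obtain r where r: "0 \<le> r" "z = ennreal r"
    by (cases z) auto
  interpret \<mu>: prob_space \<mu> by fact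
  interpret \<nu>: prob_space \<nu> by fact
  obtain \<sigma> \<mu>s where dec: "lebesgue_decomposition \<mu> \<nu> \<sigma> \<mu>s"
    using lebesgue_decomposition_exists \<mu>.finite_measure_axioms \<nu>.finite_measure_axioms sets by blast
  then have [measurable]: "\<sigma> \<in> borel_measurable \<nu>" and \<sigma>: "\<And>x. 0 \<le> \<sigma> x" and "sets \<mu>s = sets \<nu>"
    and sum: "emeasure \<mu> (space \<nu>) = emeasure (density \<nu> (\<lambda>x. ennreal (\<sigma> x))) (space \<nu>) + emeasure \<mu>s (space \<nu>)"
    by (auto simp: lebesgue_decomposition_def)
  have "space \<mu> = space \<nu>" "space \<mu>s = space \<nu>"
    using sets \<open>sets \<mu>s = sets \<nu>\<close> by (auto dest: sets_eq_imp_space_eq)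
  then have one: "1 = (\<integral>\<^sup>+x. ennreal (\<sigma> x) \<partial>\<nu>) + emeasure \<mu>s (space \<mu>s)"
    using sum \<mu>.emeasure_space_1 by (simp add: emeasure_density cong: nn_integral_cong)
  then have "(\<integral>\<^sup>+x. ennreal (\<sigma> x) \<partial>\<nu>) \<le> 1" by (metis le_iff_add)
  then have "(\<integral>\<^sup>+x. ennreal (\<sigma> x) \<partial>\<nu>) < \<infinity>" by (metis ennreal_one_less_top infinity_ennreal_def le_less_trans)
  then have int: "integrable \<nu> \<sigma>"
    using \<sigma> by (intro integrableI_nonneg) auto
  define t where "t = (\<integral>x. \<sigma> x \<partial>\<nu>)"
  have "0 \<le> t" using \<sigma> by (simp add: t_def)
  have t: "(\<integral>\<^sup>+x. ennreal (\<sigma> x) \<partial>\<nu>) = ennreal t"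
    unfolding t_def using int \<sigma> by (intro nn_integral_eq_integral) auto
  have "t \<le> 1" using \<open>(\<integral>\<^sup>+x. ennreal (\<sigma> x) \<partial>\<nu>) \<le> 1\<close> t by simp
  have mass: "emeasure \<mu>s (space \<mu>s) = ennreal (1 - t)"
  proof -
    have "emeasure \<mu>s (space \<mu>s) = 1 - ennreal t"
      using one t by (metis ennreal_add_diff_cancel_left ennreal_neq_top)
    then show ?thesis using \<open>0 \<le> t\<close> by (simp add: ennreal_minus flip: ennreal_1)
  qed
  obtain c where c: "\<And>s. 0 \<le> s \<Longrightarrow> ennreal (r + c * (s - 1)) \<le> \<phi> s"
    using entropy_affine_minorant[OF \<phi> r(1)] z r(2) by blast
  let ?f = "\<lambda>x. r + c * (\<sigma> x - 1)"
  have intf: "integrable \<nu> ?f" using int by auto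
  have "ennreal (r + c * (t - 1)) = ennreal (\<integral>x. ?f x \<partial>\<nu>)"
    using int by (simp add: t_def \<nu>.prob_space)
  also have "\<dots> \<le> ennreal (\<integral>x. max 0 (?f x) \<partial>\<nu>)"
    using intf by (intro ennreal_leI integral_mono) auto
  also have "\<dots> = (\<integral>\<^sup>+x. ennreal (max 0 (?f x)) \<partial>\<nu>)"
    using intf by (intro nn_integral_eq_integral[symmetric]) auto
  also have "\<dots> \<le> (\<integral>\<^sup>+x. \<phi> (\<sigma> x) \<partial>\<nu>)"
    using c[OF \<sigma>] by (intro nn_integral_mono) (simp add: max_def)
  finally have Jensen: "ennreal (r + c * (t - 1)) \<le> (\<integral>\<^sup>+x. \<phi> (\<sigma> x) \<partial>\<nu>)" .
  have "ennreal r \<le> (\<integral>\<^sup>+x. \<phi> (\<sigma> x) \<partial>\<nu>) + recession_slope \<phi> * emeasure \<mu>s (space \<mu>s)"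
  proof (cases "c \<le> 0")
    case True
    then have "0 \<le> c * (t - 1)" using \<open>t \<le> 1\<close> by (simp add: mult_nonpos_nonpos)
    then have "ennreal r \<le> ennreal (r + c * (t - 1))" by (intro ennreal_leI) simp
    with Jensen show ?thesis by (metis add_increasing2 order_trans zero_le)
  next
    case False
    then have "ennreal c \<le> recession_slope \<phi>"
      by (intro recession_slope_ge[OF \<phi> c r(1)]) auto
    then have "ennreal (c * (1 - t)) \<le> recession_slope \<phi> * emeasure \<mu>s (space \<mu>s)"
      using mass False \<open>t \<le> 1\<close> by (simp add: ennreal_mult mult_right_mono)
    with Jensen have "ennreal (r + c * (t - 1)) + ennreal (c * (1 - t))
        \<le> (\<integral>\<^sup>+x. \<phi> (\<sigma> x) \<partial>\<nu>) + recession_slope \<phi> * emeasure \<mu>s (space \<mu>s)"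
      by (rule add_mono)
    moreover have "ennreal r \<le> ennreal (r + c * (t - 1)) + ennreal (c * (1 - t))"
    proof -
      have "r = (r + c * (t - 1)) + c * (1 - t)" by (simp add: algebra_simps)
      also have "ennreal \<dots> \<le> ennreal (r + c * (t - 1)) + ennreal (c * (1 - t))"
      proof -
        \<comment> \<open>\<open>r + c * (t - 1)\<close> may be negative, and \<open>ennreal\<close>
          truncates it to 0; hence the detour through \<open>max\<close> and an inequality in place
          of additivity.\<close>
        have "ennreal ((r + c * (t - 1)) + c * (1 - t)) \<le> ennreal (max 0 (r + c * (t - 1)) + c * (1 - t))"
          by (intro ennreal_leI) simp
        also have "\<dots> = ennreal (max 0 (r + c * (t - 1))) + ennreal (c * (1 - t))"
          using False \<open>t \<le> 1\<close> by (intro ennreal_plus) auto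
        finally show ?thesis by (simp add: max_def ennreal_neg split: if_splits)
      qed
      finally show ?thesis .
    qed
    ultimately show ?thesis by (rule order_trans[rotated])
  qed
  also have "\<dots> = phi_divergence \<phi> \<mu> \<nu>"
    using phi_divergence_eq[OF \<mu>.finite_measure_axioms \<nu>.finite_measure_axioms sets dec] by simp
  finally show "z \<le> phi_divergence \<phi> \<mu> \<nu>" using r by simp
qed

section \<open>Uniqueness of the optimal decision\<close>

text \<open>A non-integrable \<open>f\<close> has integral 0 by convention, and \<open>K\<close> is
  nonnegative because the space is nonempty. Measurability side conditions are thereby
  avoided.\<close>

lemma (in prob_space) integral_ge_neg_bound:
  fixes f :: "'a \<Rightarrow> real"
  assumes "\<And>x. x \<in> space M \<Longrightarrow> \<bar>f x\<bar> \<le> K"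
  shows "- K \<le> (\<integral>x. f x \<partial>M)"
proof (cases "integrable M f")
  case True
  have "- K \<le> f x" if "x \<in> space M" for x using assms[OF that] by linarith
  with True show ?thesis by (intro integral_ge_const) auto
next
  case False
  obtain x where "x \<in> space M" using not_empty by auto
  with assms[of x] have "0 \<le> K" by linarith
  with False show ?thesis by (simp add: not_integrable_integral_eq)
qed

text \<open>Mass escaping to infinity is detected by \<open>1 / (1 + norm y)\<close>, which is
  bounded, continuous and strictly positive: its integrals tend to 0 along Dirac masses at points
  \<open>y n\<close> with growing norm, which is impossible for the integral under a limiting
  probability law.\<close>

lemma bounded_of_weakly_compact_joint_laws:
  fixes S :: "'a::euclidean_space set" and T :: "'b::euclidean_space set"
  assumes \<mu>: "\<mu> \<in> prob_measures_on S" and cpt: "weakly_compact_on (S \<times> T) (joint_laws S T \<mu>)"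
  shows "bounded T"
proof (rule ccontr)
  assume "\<not> bounded T"
  then have "\<forall>n::nat. \<exists>y\<in>T. real n < norm y" unfolding bounded_iff by (meson not_le)
  then obtain y where y: "\<And>n. y n \<in> T" "\<And>n. real n < norm (y n)" by metis
  interpret \<mu>: prob_space \<mu> using \<mu> by (simp add: prob_measures_on_def)
  have \<mu>_sets[measurable_cong]: "sets \<mu> = sets (borel_on S)" using \<mu> by (simp add: prob_measures_on_def)
  then have space: "space \<mu> = S" by (auto dest: sets_eq_imp_space_eq simp: space_restrict_space)
  define \<gamma> where "\<gamma> n = distr \<mu> (borel_on (S \<times> T)) (\<lambda>x. (x, y n))" for n
  have pair[measurable]: "(\<lambda>x. (x, y n)) \<in> \<mu> \<rightarrow>\<^sub>M borel_on (S \<times> T)" for n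
  proof (rule measurable_restrict_space2)
    have "(\<lambda>x. (x, y n)) \<in> borel_on S \<rightarrow>\<^sub>M borel"
      by (intro measurable_restrict_space1) simp
    then show "(\<lambda>x. (x, y n)) \<in> \<mu> \<rightarrow>\<^sub>M borel" by (simp cong: measurable_cong_sets)
  qed (use y space in auto)
  have fst[measurable]: "fst \<in> borel_on (S \<times> T) \<rightarrow>\<^sub>M borel_on S"
    by (rule measurable_restrict_space3)
      (auto intro: borel_measurable_continuous_onI continuous_on_fst[OF continuous_on_id])
  have "\<gamma> n \<in> joint_laws S T \<mu>" for n
  proof -
    have "distr (\<gamma> n) (borel_on S) fst = distr \<mu> (borel_on S) (\<lambda>x. x)"
      unfolding \<gamma>_def by (subst distr_distr) (auto simp: comp_def)
    also have "\<dots> = \<mu>" by (rule distr_id2[OF \<mu>_sets[symmetric]])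
    finally show ?thesis
      by (auto simp: joint_laws_def prob_measures_on_def \<gamma>_def intro: \<mu>.prob_space_distr)
  qed
  then obtain \<gamma>' r where \<gamma>': "\<gamma>' \<in> joint_laws S T \<mu>" and r: "strict_mono (r :: nat \<Rightarrow> nat)"
    and conv: "weakly_converges_on (S \<times> T) (\<gamma> \<circ> r) \<gamma>'"
    using cpt unfolding weakly_compact_on_def by blast
  define f where "f z = 1 / (1 + norm (snd z))" for z :: "'a \<times> 'b"
  have pos: "0 < f z" for z using norm_ge_zero[of "snd z"] by (simp add: f_def add_pos_nonneg)
  have le1: "f z \<le> 1" for z by (simp add: f_def divide_le_eq add_pos_nonneg)
  have ne: "1 + norm v \<noteq> 0" for v :: 'b using norm_ge_zero[of v] by linarith
  have cont: "continuous_on UNIV f" unfolding f_def by (intro continuous_intros) (simp add: ne)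
  then have f_meas[measurable]: "f \<in> borel_measurable (borel_on (S \<times> T))"
    by (intro measurable_restrict_space1 borel_measurable_continuous_onI)
  have "bounded (f ` (S \<times> T))"
    using pos le1 by (intro boundedI[of _ 1]) (auto simp: abs_of_pos)
  moreover have "continuous_on (S \<times> T) f" using cont by (rule continuous_on_subset) simp
  ultimately have lim: "(\<lambda>n. \<integral>z. f z \<partial>\<gamma> (r n)) \<longlonglongrightarrow> (\<integral>z. f z \<partial>\<gamma>')"
    using conv unfolding weakly_converges_on_def comp_def by blast
  have "(\<integral>z. f z \<partial>\<gamma> n) = 1 / (1 + norm (y n))" for n
    unfolding \<gamma>_def by (subst integral_distr) (auto simp: f_def \<mu>.prob_space)
  moreover have "(\<lambda>n. 1 / (1 + norm (y (r n)))) \<longlonglongrightarrow> 0"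
  proof (rule tendsto_sandwich[OF _ _ tendsto_const LIMSEQ_inverse_real_of_nat])
    show "\<forall>\<^sub>F n in sequentially. 1 / (1 + norm (y (r n))) \<le> inverse (real (Suc n))"
    proof (intro always_eventually allI)
      fix n
      have "real n \<le> norm (y (r n))"
        using y(2)[of "r n"] seq_suble[OF r, of n] by linarith
      then show "1 / (1 + norm (y (r n))) \<le> inverse (real (Suc n))"
        by (simp add: divide_simps)
    qed
  qed (simp add: always_eventually)
  ultimately have "(\<integral>z. f z \<partial>\<gamma>') = 0" using lim by (simp add: LIMSEQ_unique)
  interpret \<gamma>': prob_space \<gamma>' using \<gamma>' by (simp add: joint_laws_def prob_measures_on_def)
  have "sets \<gamma>' = sets (borel_on (S \<times> T))" using \<gamma>' by (simp add: joint_laws_def prob_measures_on_def)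
  then have "f \<in> borel_measurable \<gamma>'" using f_meas by (simp cong: measurable_cong_sets)
  then have "integrable \<gamma>' f"
    using pos le1 by (intro \<gamma>'.integrable_const_bound[of _ 1]) (auto simp: abs_of_pos)
  then have "AE z in \<gamma>'. f z = 0"
    using \<open>(\<integral>z. f z \<partial>\<gamma>') = 0\<close> by (subst (asm) integral_nonneg_eq_0_iff_AE) (auto intro!: AE_I2 less_imp_le pos)
  then have "AE z in \<gamma>'. False"
    by eventually_elim (use pos in \<open>auto simp: less_le\<close>)
  then show False by simp
qed

text \<open>By Jensen the centre \<open>\<nu>0\<close> minimises the divergence, so \<open>penalized_value\<close> grows at least like
  \<open>\<theta> * \<phi> 1\<close>; a supergradient below \<open>\<phi> 1\<close> would contradict this for large \<open>\<theta>\<close>.\<close>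

lemma entropy_one_le_of_subgradient:
  assumes \<phi>: "entropy_function \<phi>" and \<nu>0: "\<nu>0 \<in> prob_measures_on T"
    and \<mu>: "\<mu> \<in> decision_laws M S A" and K: "\<And>z. z \<in> S \<times> T \<Longrightarrow> \<bar>U z\<bar> \<le> K"
    and snd: "snd \<in> borel_on (S \<times> T) \<rightarrow>\<^sub>M borel_on T"
    and "0 < \<theta>" and sub: "\<eta> \<in> concave_subdifferential {0..} (penalized_value M S T A U \<phi> \<nu>0) \<theta>"
  shows "enn2ereal (\<phi> 1) \<le> ereal \<eta>"
proof -
  let ?J = "penalized_value M S T A U \<phi> \<nu>0"
  have lower: "ereal (- K) + ereal t * enn2ereal (\<phi> 1) \<le> ?J t" if "0 \<le> t" for t
    unfolding penalized_value_def
  proof (rule SUP_upper2[OF \<mu>], rule INF_greatest)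
    fix \<gamma> assume "\<gamma> \<in> joint_laws S T \<mu>"
    then have \<gamma>: "prob_space \<gamma>" "sets \<gamma> = sets (borel_on (S \<times> T))"
      by (auto simp: joint_laws_def prob_measures_on_def)
    interpret prob_space \<gamma> by fact
    have "space \<gamma> = S \<times> T" using sets_eq_imp_space_eq[OF \<gamma>(2)] by (simp add: space_restrict_space)
    then have "- K \<le> (\<integral>z. U z \<partial>\<gamma>)" using K by (intro integral_ge_neg_bound) auto
    have "snd \<in> \<gamma> \<rightarrow>\<^sub>M borel_on T" using snd \<gamma>(2) by (simp cong: measurable_cong_sets)
    then have "prob_space (distr \<gamma> (borel_on T) snd)" by (rule prob_space_distr)
    then have "\<phi> 1 \<le> phi_divergence \<phi> (distr \<gamma> (borel_on T) snd) \<nu>0"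
      using \<nu>0 by (intro phi_divergence_ge[OF \<phi>]) (auto simp: prob_measures_on_def)
    then have "ereal t * enn2ereal (\<phi> 1) \<le> ereal t * enn2ereal (phi_divergence \<phi> (distr \<gamma> (borel_on T) snd) \<nu>0)"
      using that by (intro ereal_mult_left_mono) (auto simp: less_eq_ennreal.rep_eq)
    then show "ereal (- K) + ereal t * enn2ereal (\<phi> 1)
      \<le> ereal (\<integral>z. U z \<partial>\<gamma>) + ereal t * enn2ereal (phi_divergence \<phi> (distr \<gamma> (borel_on T) snd) \<nu>0)"
      using \<open>- K \<le> (\<integral>z. U z \<partial>\<gamma>)\<close> by (intro add_mono) auto
  qed
  from sub have fin: "\<bar>?J \<theta>\<bar> \<noteq> \<infinity>"
    and grad: "\<And>t. 0 \<le> t \<Longrightarrow> ?J t - ?J \<theta> \<le> ereal (\<eta> * (t - \<theta>))"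
    by (auto simp: concave_subdifferential_def)
  obtain j where j: "?J \<theta> = ereal j" using fin by auto
  \<comment> \<open>With \<open>\<theta> > 0\<close> the penalty would be infinite, against the
    finiteness of \<open>?J \<theta>\<close> that a supergradient presupposes.\<close>
  have "\<phi> 1 \<noteq> \<infinity>"
  proof
    assume "\<phi> 1 = \<infinity>"
    then have "?J \<theta> = \<infinity>" using lower[of \<theta>] \<open>0 < \<theta>\<close> by simp
    with fin show False by simp
  qed
  then obtain p where p: "0 \<le> p" "\<phi> 1 = ennreal p" by (cases "\<phi> 1") auto
  have bound: "- K + t * p - j \<le> \<eta> * (t - \<theta>)" if "0 \<le> t" for t
  proof -
    have "ereal (- K + t * p - j) \<le> ?J t - ?J \<theta>"
      using lower[OF that] p by (cases "?J t") (auto simp: j)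
    also note grad[OF that]
    finally show ?thesis by simp
  qed
  have "p \<le> \<eta>"
  proof (rule ccontr)
    assume "\<not> p \<le> \<eta>"
    \<comment> \<open>\<open>bound\<close> rearranges to
      \<open>t * (p - \<eta>) \<le> K + j - \<eta> * \<theta>\<close>; this \<open>t\<close> makes
      the left side too large by at least 1.\<close>
    define t where "t = (\<bar>K + j - \<eta> * \<theta>\<bar> + 1) / (p - \<eta>)"
    have "0 \<le> t" using \<open>\<not> p \<le> \<eta>\<close> by (simp add: t_def)
    moreover have "t * (p - \<eta>) = \<bar>K + j - \<eta> * \<theta>\<bar> + 1" using \<open>\<not> p \<le> \<eta>\<close> by (simp add: t_def)
    ultimately show False using bound[of t] by (auto simp: algebra_simps)
  qed
  then show ?thesis using p by simp
qed

lemma borel_measurable_composed_pair: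
  fixes U :: "'a::euclidean_space \<times> 'b::euclidean_space \<Rightarrow> real"
  assumes "continuous_on (S \<times> T) U" and "X \<in> M \<rightarrow>\<^sub>M borel_on S" and "Y \<in> M \<rightarrow>\<^sub>M borel_on T"
  shows "(\<lambda>\<omega>. U (X \<omega>, Y \<omega>)) \<in> borel_measurable M"
proof -
  have X: "X \<in> borel_measurable M" "X \<in> space M \<rightarrow> S" and Y: "Y \<in> borel_measurable M" "Y \<in> space M \<rightarrow> T"
    using assms(2,3) by (auto simp: measurable_restrict_space2_iff)
  have "(\<lambda>\<omega>. (X \<omega>, Y \<omega>)) \<in> M \<rightarrow>\<^sub>M borel_on (S \<times> T)"
    using X Y by (intro measurable_restrict_space2 borel_measurable_Pair) auto
  then show ?thesis
    by (rule measurable_compose[OF _ borel_measurable_continuous_on_restrict[OF assms(1)]])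
qed

text \<open>The event on which the gap is at least \<open>1 / Suc n\<close> for all \<open>y\<close>
  simultaneously does not depend on \<open>Y\<close>. Compactness of \<open>T\<close> makes these
  events cover \<open>X1 \<noteq> X2\<close>, so one of them has positive probability; elsewhere the
  gap is still nonnegative.\<close>

lemma strictly_concave_midpoint_gap:
  fixes U :: "'a::euclidean_space \<times> 'b::euclidean_space \<Rightarrow> real"
  assumes "prob_space M" and "closed S" and "convex S" and "compact T"
    and U: "continuous_on (S \<times> T) U" and K: "\<And>z. z \<in> S \<times> T \<Longrightarrow> \<bar>U z\<bar> \<le> K"
    and conc: "\<And>y. y \<in> T \<Longrightarrow> strictly_concave_on S (\<lambda>x. U (x, y))"
    and X: "X1 \<in> M \<rightarrow>\<^sub>M borel_on S" "X2 \<in> M \<rightarrow>\<^sub>M borel_on S" "X \<in> M \<rightarrow>\<^sub>M borel_on S"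
    and mid: "AE \<omega> in M. X \<omega> = (1 / 2) *\<^sub>R X1 \<omega> + (1 / 2) *\<^sub>R X2 \<omega>"
    and ne: "\<not> (AE \<omega> in M. X1 \<omega> = X2 \<omega>)"
  obtains \<delta> where "0 < \<delta>" "\<And>Y. Y \<in> M \<rightarrow>\<^sub>M borel_on T \<Longrightarrow>
    ((\<integral>\<omega>. U (X1 \<omega>, Y \<omega>) \<partial>M) + (\<integral>\<omega>. U (X2 \<omega>, Y \<omega>) \<partial>M)) / 2 + \<delta> \<le> (\<integral>\<omega>. U (X \<omega>, Y \<omega>) \<partial>M)"
proof -
  interpret prob_space M by fact
  have X_in: "X1 \<omega> \<in> S" "X2 \<omega> \<in> S" if "\<omega> \<in> space M" for \<omega>
    using X(1,2)[THEN measurable_space, OF that] by (auto simp: space_restrict_space)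
  have [measurable]: "X1 \<in> borel_measurable M" "X2 \<in> borel_measurable M"
    using X by (auto simp: measurable_restrict_space2_iff)
  have mid_in: "(1 / 2) *\<^sub>R a + (1 / 2) *\<^sub>R b \<in> S" if "a \<in> S" "b \<in> S" for a b
    using convexD[OF \<open>convex S\<close> that, of "1/2" "1/2"] by simp
  define gap where "gap p y = U ((1 / 2) *\<^sub>R fst p + (1 / 2) *\<^sub>R snd p, y) - (U (fst p, y) + U (snd p, y)) / 2" for p y
  have gap_pos: "0 < gap (a, b) y" if "a \<in> S" "b \<in> S" "a \<noteq> b" "y \<in> T" for a b y
  proof -
    have "(1 - t) * U (a, y) + t * U (b, y) < U ((1 - t) *\<^sub>R a + t *\<^sub>R b, y)" if "0 < t" "t < 1" for t
      using conc[OF \<open>y \<in> T\<close>] \<open>a \<in> S\<close> \<open>b \<in> S\<close> \<open>a \<noteq> b\<close> that unfolding strictly_concave_on_def by blast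
    from this[of "1 / 2"] show ?thesis by (simp add: gap_def add_divide_distrib)
  qed
  have gap_nonneg: "0 \<le> gap (a, b) y" if "a \<in> S" "b \<in> S" "y \<in> T" for a b y
    using gap_pos[OF that(1,2) _ that(3)] by (cases "a = b") (auto simp: gap_def intro: less_imp_le simp flip: scaleR_left_distrib)
  have gap_cont: "continuous_on (S \<times> S) (\<lambda>p. gap p y)" if "y \<in> T" for y
    unfolding gap_def using that mid_in
    by (intro continuous_intros continuous_on_compose2[OF U]) auto
  have gap_cont': "continuous_on T (gap (a, b))" if "a \<in> S" "b \<in> S" for a b
    unfolding gap_def using that mid_in
    by (intro continuous_intros continuous_on_compose2[OF U]) auto
  \<comment> \<open>An infimum over uncountably many \<open>y\<close> could spoil measurability; an
    intersection of closed superlevel sets is closed, hence Borel.\<close>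
  define C where "C n = (S \<times> S) \<inter> (\<Inter>y\<in>T. {p \<in> S \<times> S. 1 / real (Suc n) \<le> gap p y})" for n
  have "closed (C n)" for n
    unfolding C_def using \<open>closed S\<close>
    by (intro closed_Int closed_Times closed_INT ballI continuous_on_closed_Collect_le gap_cont) (auto intro: closed_Times)
  then have [measurable]: "C n \<in> sets borel" for n by simp
  define E where "E n = {\<omega> \<in> space M. (X1 \<omega>, X2 \<omega>) \<in> C n}" for n
  have E[measurable]: "E n \<in> sets M" for n unfolding E_def by measurable
  have "\<exists>n. 0 < measure M (E n)"
  proof (rule ccontr)
    assume "\<nexists>n. 0 < measure M (E n)"
    then have "emeasure M (E n) = 0" for n
      by (metis emeasure_eq_measure ennreal_0 measure_nonneg order_less_le)
    then have "(\<Union>n. E n) \<in> null_sets M" by (intro null_sets_UN) auto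
    moreover have "{\<omega> \<in> space M. X1 \<omega> \<noteq> X2 \<omega>} \<subseteq> (\<Union>n. E n)"
    proof
      fix \<omega> assume \<omega>: "\<omega> \<in> {\<omega> \<in> space M. X1 \<omega> \<noteq> X2 \<omega>}"
      let ?p = "(X1 \<omega>, X2 \<omega>)"
      obtain m where m: "0 < m" "\<And>y. y \<in> T \<Longrightarrow> m \<le> gap ?p y"
      proof (cases "T = {}")
        case True
        then show ?thesis using that[of 1] by auto
      next
        case False
        then obtain y where "y \<in> T" "\<And>y'. y' \<in> T \<Longrightarrow> gap ?p y \<le> gap ?p y'"
          using continuous_attains_inf[OF \<open>compact T\<close> _ gap_cont'] X_in \<omega> by (metis (no_types, lifting) mem_Collect_eq)
        then show ?thesis using that[of "gap ?p y"] gap_pos X_in \<omega> by auto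
      qed
      obtain n where "1 / real (Suc n) < m"
        using reals_Archimedean[OF m(1)] by (auto simp: inverse_eq_divide)
      then have "\<omega> \<in> E n"
        using m(2) X_in \<omega> by (force simp: E_def C_def)
      then show "\<omega> \<in> (\<Union>n. E n)" by blast
    qed
    ultimately have "AE \<omega> in M. X1 \<omega> = X2 \<omega>" by (intro AE_I') auto
    with ne show False by simp
  qed
  then obtain n where n: "0 < measure M (E n)" by blast
  show thesis
  proof (rule that[of "measure M (E n) / Suc n"])
    fix Y assume Y: "Y \<in> M \<rightarrow>\<^sub>M borel_on T"
    have Y_in: "Y \<omega> \<in> T" if "\<omega> \<in> space M" for \<omega>
      using measurable_space[OF Y that] by (simp add: space_restrict_space)
    have int: "integrable M (\<lambda>\<omega>. U (Z \<omega>, Y \<omega>))" if Z: "Z \<in> M \<rightarrow>\<^sub>M borel_on S" for Z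
    proof (rule integrable_const_bound[of _ K])
      show "AE \<omega> in M. norm (U (Z \<omega>, Y \<omega>)) \<le> K"
        using measurable_space[OF Z] Y_in by (intro AE_I2) (auto intro!: K simp: space_restrict_space)
    qed (rule borel_measurable_composed_pair[OF U Z Y])
    have intE: "integrable M (\<lambda>\<omega>. indicator (E n) \<omega> / real (Suc n))"
      by (intro integrable_const_bound[of _ 1]) (auto simp: indicator_def)
    have "measure M (E n) / Suc n = (\<integral>\<omega>. indicator (E n) \<omega> / Suc n \<partial>M)" by simp
    also have "\<dots> \<le> (\<integral>\<omega>. U (X \<omega>, Y \<omega>) - (U (X1 \<omega>, Y \<omega>) + U (X2 \<omega>, Y \<omega>)) / 2 \<partial>M)"
    proof (rule integral_mono_AE)
      show "AE \<omega> in M. indicator (E n) \<omega> / Suc n \<le> U (X \<omega>, Y \<omega>) - (U (X1 \<omega>, Y \<omega>) + U (X2 \<omega>, Y \<omega>)) / 2"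
        using mid AE_space
      proof eventually_elim
        case (elim \<omega>)
        have "indicator (E n) \<omega> / Suc n \<le> gap (X1 \<omega>, X2 \<omega>) (Y \<omega>)"
          using gap_nonneg[of "X1 \<omega>" "X2 \<omega>" "Y \<omega>"] X_in Y_in elim by (auto simp: indicator_def E_def C_def)
        then show ?case using elim by (simp add: gap_def)
      qed
    qed (use int X intE in \<open>auto simp del: of_nat_Suc\<close>)
    also have "\<dots> = (\<integral>\<omega>. U (X \<omega>, Y \<omega>) \<partial>M) - ((\<integral>\<omega>. U (X1 \<omega>, Y \<omega>) \<partial>M) + (\<integral>\<omega>. U (X2 \<omega>, Y \<omega>) \<partial>M)) / 2"
      using int X by simp
    finally show "((\<integral>\<omega>. U (X1 \<omega>, Y \<omega>) \<partial>M) + (\<integral>\<omega>. U (X2 \<omega>, Y \<omega>) \<partial>M)) / 2 + measure M (E n) / Suc n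
        \<le> (\<integral>\<omega>. U (X \<omega>, Y \<omega>) \<partial>M)" by linarith
  qed (use n in simp)
qed

theorem theorem5p2:
  fixes M :: "'w measure"
    and \<X> :: "(real ^ 'n) set" and \<Y> :: "(real ^ 'm) set"
    and \<A> :: "('w \<Rightarrow> real ^ 'n) set"
    and U :: "(real ^ 'n) \<times> (real ^ 'm) \<Rightarrow> real"
    and \<phi> :: "real \<Rightarrow> ennreal" and \<nu>0 :: "(real ^ 'm) measure" and \<eta> :: real
  assumes "prob_space M" and "complete_measure M" and "nonatomic M"
    and "closed \<X>" and "convex \<X>" and "closed \<Y>" and "convex \<Y>"
    and "\<A> \<subseteq> M \<rightarrow>\<^sub>M borel_on \<X>"
    and "entropy_function \<phi>" and "\<nu>0 \<in> prob_measures_on \<Y>"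
    and a: "continuous_on (\<X> \<times> \<Y>) U" "bounded (U ` (\<X> \<times> \<Y>))"
    and b: "convex_decisions M \<A>" "weakly_compact_on \<X> (decision_laws M \<X> \<A>)"
    and c: "\<And>y. y \<in> \<Y> \<Longrightarrow> strictly_concave_on \<X> (\<lambda>x. U (x, y))"
    and d: "recession_slope \<phi> = \<infinity> \<or> (\<forall>\<alpha>::real. compact {z \<in> \<X> \<times> \<Y>. U z \<le> \<alpha>})"
    and e: "\<And>\<mu>. \<mu> \<in> decision_laws M \<X> \<A> \<Longrightarrow> weakly_compact_on (\<X> \<times> \<Y>) (joint_laws \<X> \<Y> \<mu>)"
    and \<eta>: "\<eta> \<in> (\<Union>\<theta>\<in>{0<..}. concave_subdifferential {0..} (penalized_value M \<X> \<Y> \<A> U \<phi> \<nu>0) \<theta>)"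
  shows "\<forall>X1 X2. optimal_decision M \<Y> \<A> U \<phi> \<nu>0 \<eta> X1 \<longrightarrow> optimal_decision M \<Y> \<A> U \<phi> \<nu>0 \<eta> X2 \<longrightarrow>
           (AE \<omega> in M. X1 \<omega> = X2 \<omega>)"
proof (intro allI impI)
  fix X1 X2
  assume opt: "optimal_decision M \<Y> \<A> U \<phi> \<nu>0 \<eta> X1" "optimal_decision M \<Y> \<A> U \<phi> \<nu>0 \<eta> X2"
  interpret prob_space M by fact
  let ?wc = "worst_case_value M \<Y> U \<phi> \<nu>0 \<eta>" and ?v = "constrained_value M \<Y> \<A> U \<phi> \<nu>0 \<eta>"
  have X_in: "X1 \<in> \<A>" "X2 \<in> \<A>" and wc: "?wc X1 = ?v" "?wc X2 = ?v"
    using opt by (auto simp: optimal_decision_def)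
  then have X: "X1 \<in> M \<rightarrow>\<^sub>M borel_on \<X>" "X2 \<in> M \<rightarrow>\<^sub>M borel_on \<X>" using \<open>\<A> \<subseteq> _\<close> by auto
  obtain K where K: "\<And>z. z \<in> \<X> \<times> \<Y> \<Longrightarrow> \<bar>U z\<bar> \<le> K"
    using a(2) by (auto simp: bounded_iff)
  \<comment> \<open>The law of an optimal decision shows that \<open>decision_laws\<close> is
    nonempty; both the compactness of \<Y> and the growth of the penalized value are drawn from
    it.\<close>
  have \<mu>: "distr M (borel_on \<X>) X1 \<in> decision_laws M \<X> \<A>"
    using X(1) X_in by (auto simp: decision_laws_def prob_measures_on_def intro: prob_space_distr)
  have "bounded \<Y>"
    using \<mu> by (intro bounded_of_weakly_compact_joint_laws[OF _ e[OF \<mu>]]) (simp add: decision_laws_def)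
  then have "compact \<Y>" using \<open>closed \<Y>\<close> by (simp add: compact_eq_bounded_closed)
  obtain \<theta> where \<theta>: "0 < \<theta>" "\<eta> \<in> concave_subdifferential {0..} (penalized_value M \<X> \<Y> \<A> U \<phi> \<nu>0) \<theta>"
    using \<eta> by auto
  have "snd \<in> borel_on (\<X> \<times> \<Y>) \<rightarrow>\<^sub>M borel_on \<Y>"
    by (rule measurable_restrict_space3)
      (auto intro: borel_measurable_continuous_onI continuous_on_snd[OF continuous_on_id])
  then have "enn2ereal (\<phi> 1) \<le> ereal \<eta>"
    using entropy_one_le_of_subgradient[OF \<open>entropy_function \<phi>\<close> \<open>\<nu>0 \<in> prob_measures_on \<Y>\<close> \<mu> K _ \<theta>] by blast
  then have \<nu>0: "\<nu>0 \<in> ambiguity_set \<Y> \<phi> \<nu>0 \<eta>"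
    using \<open>\<nu>0 \<in> prob_measures_on \<Y>\<close> by (simp add: ambiguity_set_def prob_measures_on_def phi_divergence_self)
  let ?Ys = "{Y \<in> M \<rightarrow>\<^sub>M borel_on \<Y>. distr M (borel_on \<Y>) Y \<in> ambiguity_set \<Y> \<phi> \<nu>0 \<eta>}"
  obtain Y0 where Y0: "Y0 \<in> ?Ys"
    using nonatomic_realization_on[OF \<open>prob_space M\<close> \<open>nonatomic M\<close> \<open>closed \<Y>\<close> \<open>\<nu>0 \<in> prob_measures_on \<Y>\<close>] \<nu>0 by (metis (no_types, lifting) mem_Collect_eq)
  have wc_le: "?wc X \<le> ereal (\<integral>\<omega>. U (X \<omega>, Y \<omega>) \<partial>M)" if "Y \<in> ?Ys" for X Y
    unfolding worst_case_value_def using that by (rule INF_lower)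
  have le: "?v \<le> ereal (\<integral>\<omega>. U (X1 \<omega>, Y \<omega>) \<partial>M)" "?v \<le> ereal (\<integral>\<omega>. U (X2 \<omega>, Y \<omega>) \<partial>M)" if "Y \<in> ?Ys" for Y
    using wc_le[OF that, of X1] wc_le[OF that, of X2] wc by auto
  have "ereal (- K) \<le> ?v"
    unfolding wc(1)[symmetric] worst_case_value_def
  proof (intro INF_greatest)
    fix Y assume "Y \<in> ?Ys"
    then show "ereal (- K) \<le> ereal (\<integral>\<omega>. U (X1 \<omega>, Y \<omega>) \<partial>M)"
      using measurable_space[OF X(1)] measurable_space[of Y M "borel_on \<Y>"]
      by (auto intro!: integral_ge_neg_bound K simp: space_restrict_space)
  qed
  \<comment> \<open>Finiteness is what makes \<open>v + \<delta> \<le> v\<close> absurd in the end;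
    the upper bound is where an admissible \<open>Y0\<close> is indispensable.\<close>
  with le(1)[OF Y0] obtain v where v: "?v = ereal v" by (cases ?v) auto
  have "\<exists>X\<in>\<A>. AE \<omega> in M. X \<omega> = (1 - t) *\<^sub>R X1 \<omega> + t *\<^sub>R X2 \<omega>" if "t \<in> {0..1}" for t
    using b(1) X_in that unfolding convex_decisions_def by blast
  from this[of "1 / 2"] obtain X where "X \<in> \<A>"
    and mid: "AE \<omega> in M. X \<omega> = (1 / 2) *\<^sub>R X1 \<omega> + (1 / 2) *\<^sub>R X2 \<omega>" by auto
  then have "X \<in> M \<rightarrow>\<^sub>M borel_on \<X>" using \<open>\<A> \<subseteq> _\<close> by auto
  show "AE \<omega> in M. X1 \<omega> = X2 \<omega>"
  proof (rule ccontr)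
    assume "\<not> ?thesis"
    then obtain \<delta> where \<delta>: "0 < \<delta>" "\<And>Y. Y \<in> M \<rightarrow>\<^sub>M borel_on \<Y> \<Longrightarrow>
      ((\<integral>\<omega>. U (X1 \<omega>, Y \<omega>) \<partial>M) + (\<integral>\<omega>. U (X2 \<omega>, Y \<omega>) \<partial>M)) / 2 + \<delta> \<le> (\<integral>\<omega>. U (X \<omega>, Y \<omega>) \<partial>M)"
      using strictly_concave_midpoint_gap[OF \<open>prob_space M\<close> \<open>closed \<X>\<close> \<open>convex \<X>\<close> \<open>compact \<Y>\<close> a(1) K c
          X \<open>X \<in> M \<rightarrow>\<^sub>M borel_on \<X>\<close> mid] by blast
    have "ereal (v + \<delta>) \<le> ?wc X"
      unfolding worst_case_value_def
    proof (intro INF_greatest)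
      fix Y assume Y: "Y \<in> ?Ys"
      have "v + \<delta> \<le> (\<integral>\<omega>. U (X \<omega>, Y \<omega>) \<partial>M)"
      proof -
        \<comment> \<open>The same \<open>Y\<close> is used for both decisions and their midpoint:
          each decision earns at least the optimal value against any admissible \<open>Y\<close>, so
          no minimizer has to be selected.\<close>
        have "2 * v \<le> (\<integral>\<omega>. U (X1 \<omega>, Y \<omega>) \<partial>M) + (\<integral>\<omega>. U (X2 \<omega>, Y \<omega>) \<partial>M)"
          using le[OF Y] by (simp add: v)
        with \<delta>(2)[of Y] Y show ?thesis by (simp add: field_simps)
      qed
      then show "ereal (v + \<delta>) \<le> ereal (\<integral>\<omega>. U (X \<omega>, Y \<omega>) \<partial>M)" by simp
    qed
    also have "\<dots> \<le> ?v" unfolding constrained_value_def using \<open>X \<in> \<A>\<close> by (rule SUP_upper)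
    finally show False using \<delta>(1) by (simp add: v)
  qed
qed

end
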